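(* Let $(X,T)$ be a Cantor minimal system of finite rank $d$. Let $\mu_1,\dots,\mu_l$, $l\leq d$, be all its ergodic ($T$-invariant Borel probability) measures. Then $$\eta(X,T)\leq d-l+1 .$$
   Context: A Cantor minimal system $(X,T)$ is a homeomorphism $T$ of a Cantor set $X$ all of whose orbits are dense. A complex number $\lambda$ is a continuous eigenvalue of $(X,T)$ if there is a continuous $f:X\to\mathbb{C}$, $f\neq 0$, with $f\circ T=\lambda f$. Put $E(X,T)=\{\alpha\in\mathbb{R}:\exp(2i\pi\alpha)\text{ is a continuous eigenvalue of }(X,T)\}$ (an additive group containing $\mathbb{Z}$), and let $\eta(X,T)$ be the maximal number of rationally independent (i.e. linearly independent over $\mathbb{Q}$) elements of $E(X,T)$. Bratteli-Vershik representations. A Bratteli diagram is an infinite graph with vertex set $V=\bigsqcup_{n\ge0}V_n$ and edge set $E=\bigsqcup_{n\ge1}E_n$, all levels finite, $V_0=\{v_0\}$, $V_n=\{1,\dots,C(n)\}$ for $n\geq 1$; edges in $E_n$ go from $V_{n-1}$ (initial point) to $V_n$ (end-point); every vertex of $V_n$, $n\ge1$, is the end-point of an edge of $E_n$ and every vertex of $V_n$, $n\ge 0$, is the initial point of an edge of $E_{n+1}$. It is ordered by a partial order $\preceq$ on $E$ for which two edges are comparable iff they have the same end-point. $X_B$ is the compact space of infinite paths $(e_1,e_2,\dots)$, $e_n\in E_n$, starting at $v_0$, with basis the cylinder sets $[e_1,\dots,e_n]$. The diagram is properly ordered if there is exactly one path $x_{\max}$ all of whose edges are maximal and exactly one path $x_{\min}$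 all of whose edges are minimal. The Vershik map $V_B$ sends $x_{\max}$ to $x_{\min}$ and, for $x\ne x_{\max}$, if $k$ is least with $x_k$ not maximal, sends $x$ to $(y_1,\dots,y_{k-1},y_k,x_{k+1},\dots)$ where $y_k$ is the successor of $x_k$ and $(y_1,\dots,y_{k-1})$ is the path of minimal edges from $v_0$ to the initial point of $y_k$. $(X,T)$ is given by $B$ if $B$ is properly ordered and $(X,T)=(X_B,V_B)$ up to conjugacy. Standing assumptions (not restrictive): there is at least one edge from each vertex of $V_{n-1}$ to each vertex of $V_n$ ($n\ge2$), and exactly one edge from $v_0$ to each vertex of $V_1$. $(X,T)$ is of (topological) finite rank $d\ge1$ if it is given by such a representation with $C(n)\le d$ for all $n\ge1$. *)

theory Defs
  imports "HOL-Probability.Probability"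
begin

definition cantor_space :: "'a topology \<Rightarrow> bool" where
  "cantor_space X \<longleftrightarrow>
     X homeomorphic_space
       product_topology (\<lambda>_::nat. discrete_topology (UNIV :: bool set)) UNIV"

definition orbit_on :: "'a topology \<Rightarrow> ('a \<Rightarrow> 'a) \<Rightarrow> 'a \<Rightarrow> 'a set" where
  "orbit_on X T x =
     range (\<lambda>n::nat. (T ^^ n) x) \<union> range (\<lambda>n::nat. (inv_into (topspace X) T ^^ n) x)"

definition cantor_minimal_system :: "'a topology \<Rightarrow> ('a \<Rightarrow> 'a) \<Rightarrow> bool" where
  "cantor_minimal_system X T \<longleftrightarrow>
     cantor_space X \<and> homeomorphic_map X X T \<and>
     (\<forall>x\<in>topspace X. X closure_of (orbit_on X T x) = topspace X)"

definition conjugate_systems ::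
    "'a topology \<Rightarrow> ('a \<Rightarrow> 'a) \<Rightarrow> 'b topology \<Rightarrow> ('b \<Rightarrow> 'b) \<Rightarrow> bool" where
  "conjugate_systems X T Y S \<longleftrightarrow>
     (\<exists>h. homeomorphic_map X Y h \<and> (\<forall>x\<in>topspace X. h (T x) = S (h x)))"

definition continuous_eigenvalue :: "'a topology \<Rightarrow> ('a \<Rightarrow> 'a) \<Rightarrow> complex \<Rightarrow> bool" where
  "continuous_eigenvalue X T c \<longleftrightarrow>
     (\<exists>f :: 'a \<Rightarrow> complex. continuous_map X euclidean f \<and>
        (\<exists>x\<in>topspace X. f x \<noteq> 0) \<and> (\<forall>x\<in>topspace X. f (T x) = c * f x))"

definition eigenvalue_group :: "'a topology \<Rightarrow> ('a \<Rightarrow> 'a) \<Rightarrow> real set" where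
  "eigenvalue_group X T =
     {\<alpha>. continuous_eigenvalue X T (exp (2 * \<i> * complex_of_real pi * complex_of_real \<alpha>))}"

definition rationally_independent :: "real set \<Rightarrow> bool" where
  "rationally_independent S \<longleftrightarrow> module.independent (\<lambda>(q::rat) (x::real). of_rat q * x) S"

text \<open>The supremum is taken in the extended naturals, so that a system with rationally independent
  sets of eigenvalues of unbounded size gets the value infinity.\<close>

definition eta :: "'a topology \<Rightarrow> ('a \<Rightarrow> 'a) \<Rightarrow> enat" where
  "eta X T =
     (SUP S \<in> {S. finite S \<and> S \<subseteq> eigenvalue_group X T \<and> rationally_independent S}. enat (card S))"

definition invariant_measure :: "'a topology \<Rightarrow> ('a \<Rightarrow> 'a) \<Rightarrow> 'a measure \<Rightarrow> bool" where
  "invariant_measure X T M \<longleftrightarrow>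
     prob_space M \<and> space M = topspace X \<and>
     sets M = sigma_sets (topspace X) {U. openin X U} \<and>
     (\<forall>A\<in>sets M. emeasure M (T -` A \<inter> space M) = emeasure M A)"

definition ergodic_measures :: "'a topology \<Rightarrow> ('a \<Rightarrow> 'a) \<Rightarrow> 'a measure set" where
  "ergodic_measures X T =
     {M. invariant_measure X T M \<and>
         (\<forall>A\<in>sets M. T -` A \<inter> space M = A \<longrightarrow> emeasure M A = 0 \<or> emeasure M A = 1)}"

text \<open>The vertices are tagged with their level: \<open>(n, i)\<close> is the vertex \<open>i\<close> of level \<open>n\<close>,
  and \<open>(0, 0)\<close> is the root. The values \<open>num_vertices B 0\<close> and \<open>edges B 0\<close> are not used.\<close>

record 'e bratteli_diagram =
  num_vertices :: "nat \<Rightarrow> nat"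
  edges :: "nat \<Rightarrow> 'e set"
  init_pt :: "'e \<Rightarrow> nat \<times> nat"
  end_pt :: "'e \<Rightarrow> nat \<times> nat"
  edge_order :: "('e \<times> 'e) set"

definition vertices :: "('e, 'z) bratteli_diagram_scheme \<Rightarrow> nat \<Rightarrow> (nat \<times> nat) set" where
  "vertices B n = (if n = 0 then {(0, 0)} else {n} \<times> {1..num_vertices B n})"

definition all_edges :: "('e, 'z) bratteli_diagram_scheme \<Rightarrow> 'e set" where
  "all_edges B = (\<Union>n\<in>{1..}. edges B n)"

definition ordered_bratteli_diagram :: "('e, 'z) bratteli_diagram_scheme \<Rightarrow> bool" where
  "ordered_bratteli_diagram B \<longleftrightarrow>
     disjoint_family_on (edges B) {1..} \<and>
     (\<forall>n\<ge>1. finite (edges B n)) \<and>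
     (\<forall>n\<ge>1. \<forall>e\<in>edges B n. init_pt B e \<in> vertices B (n - 1) \<and> end_pt B e \<in> vertices B n) \<and>
     (\<forall>n\<ge>1. \<forall>v\<in>vertices B n. \<exists>e\<in>edges B n. end_pt B e = v) \<and>
     (\<forall>n. \<forall>v\<in>vertices B n. \<exists>e\<in>edges B (n + 1). init_pt B e = v) \<and>
     partial_order_on (all_edges B) (edge_order B) \<and>
     (\<forall>e\<in>all_edges B. \<forall>f\<in>all_edges B.
        ((e, f) \<in> edge_order B \<or> (f, e) \<in> edge_order B) \<longleftrightarrow> end_pt B e = end_pt B f)"

definition standing_assumptions :: "('e, 'z) bratteli_diagram_scheme \<Rightarrow> bool" where
  "standing_assumptions B \<longleftrightarrow>
     (\<forall>n\<ge>2. \<forall>u\<in>vertices B (n - 1). \<forall>v\<in>vertices B n.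
        \<exists>e\<in>edges B n. init_pt B e = u \<and> end_pt B e = v) \<and>
     (\<forall>v\<in>vertices B 1. \<exists>!e. e \<in> edges B 1 \<and> init_pt B e = (0, 0) \<and> end_pt B e = v)"

definition maximal_edge :: "('e, 'z) bratteli_diagram_scheme \<Rightarrow> 'e \<Rightarrow> bool" where
  "maximal_edge B e \<longleftrightarrow> (\<forall>f. (e, f) \<in> edge_order B \<longrightarrow> f = e)"

definition minimal_edge :: "('e, 'z) bratteli_diagram_scheme \<Rightarrow> 'e \<Rightarrow> bool" where
  "minimal_edge B e \<longleftrightarrow> (\<forall>f. (f, e) \<in> edge_order B \<longrightarrow> f = e)"

definition edge_succ :: "('e, 'z) bratteli_diagram_scheme \<Rightarrow> 'e \<Rightarrow> 'e" where
  "edge_succ B e =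
     (THE f. (e, f) \<in> edge_order B \<and> f \<noteq> e \<and>
        (\<forall>g. (e, g) \<in> edge_order B \<and> g \<noteq> e \<longrightarrow> (f, g) \<in> edge_order B))"

text \<open>Positions on a path are counted from \<open>0\<close>: the edge \<open>x n\<close> lies in \<open>edges B (Suc n)\<close>,
  so a path necessarily starts at the root.\<close>

definition paths :: "('e, 'z) bratteli_diagram_scheme \<Rightarrow> (nat \<Rightarrow> 'e) set" where
  "paths B =
     {x. \<forall>n. x n \<in> edges B (Suc n) \<and> init_pt B (x (Suc n)) = end_pt B (x n)}"

definition cylinder ::
    "('e, 'z) bratteli_diagram_scheme \<Rightarrow> (nat \<Rightarrow> 'e) \<Rightarrow> nat \<Rightarrow> (nat \<Rightarrow> 'e) set" where
  "cylinder B x n = {y \<in> paths B. \<forall>k<n. y k = x k}"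

definition path_space :: "('e, 'z) bratteli_diagram_scheme \<Rightarrow> (nat \<Rightarrow> 'e) topology" where
  "path_space B = topology_generated_by {cylinder B x n | x n. x \<in> paths B}"

definition max_path :: "('e, 'z) bratteli_diagram_scheme \<Rightarrow> (nat \<Rightarrow> 'e) \<Rightarrow> bool" where
  "max_path B x \<longleftrightarrow> x \<in> paths B \<and> (\<forall>n. maximal_edge B (x n))"

definition min_path :: "('e, 'z) bratteli_diagram_scheme \<Rightarrow> (nat \<Rightarrow> 'e) \<Rightarrow> bool" where
  "min_path B x \<longleftrightarrow> x \<in> paths B \<and> (\<forall>n. minimal_edge B (x n))"

definition properly_ordered :: "('e, 'z) bratteli_diagram_scheme \<Rightarrow> bool" where
  "properly_ordered B \<longleftrightarrow>
     ordered_bratteli_diagram B \<and> (\<exists>!x. max_path B x) \<and> (\<exists>!x. min_path B x)"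

text \<open>In the second case the image is the only path that has the prescribed edges from position
  \<open>k\<close> on and minimal edges before.\<close>

definition vershik_map ::
    "('e, 'z) bratteli_diagram_scheme \<Rightarrow> (nat \<Rightarrow> 'e) \<Rightarrow> (nat \<Rightarrow> 'e)" where
  "vershik_map B x =
     (if max_path B x then (THE y. min_path B y)
      else let k = (LEAST k. \<not> maximal_edge B (x k)) in
        THE y. y \<in> paths B \<and> (\<forall>n<k. minimal_edge B (y n)) \<and>
               y k = edge_succ B (x k) \<and> (\<forall>n>k. y n = x n))"

text \<open>A diagram has countably many edges, so it is no restriction to take natural numbers as
  edges.\<close>

definition finite_rank :: "'a topology \<Rightarrow> ('a \<Rightarrow> 'a) \<Rightarrow> nat \<Rightarrow> bool" where
  "finite_rank X T d \<longleftrightarrow> d \<ge> 1 \<and>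
     (\<exists>B :: nat bratteli_diagram.
        properly_ordered B \<and> standing_assumptions B \<and>
        conjugate_systems X T (path_space B) (vershik_map B) \<and>
        (\<forall>n\<ge>1. num_vertices B n \<le> d))"

end

theory Submission
  imports Defs
begin

text \<open>Let \<open>h n v\<close> be the height of the tower over the vertex \<open>v\<close> of level \<open>n\<close>. An eigenfunction is
  nearly constant on the union of the tower bases, which shrinks to the minimal path. So for an
  eigenvalue \<open>\<alpha>\<close> the numbers \<open>\<alpha> * h n v\<close> are close to integers \<open>k n v\<close>, and for large \<open>n\<close> both \<open>k\<close>
  and the error \<open>\<alpha> * h - k\<close> are transported from level to level by the incidence matrices. For an
  invariant measure let \<open>m n v\<close> be the measure of the tower base over \<open>v\<close>. The pairing of \<open>m n\<close>
  with the error does not depend on \<open>n\<close> and tends to \<open>0\<close>, so it vanishes, and the pairing of \<open>m n\<close>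
  with \<open>k n\<close> is \<open>\<alpha>\<close>. Hence the vectors \<open>k n\<close> of rationally independent eigenvalues, which are linearly
  independent, are orthogonal to the differences of the vectors \<open>m n\<close> of the \<open>l\<close> ergodic measures.
  Ergodic measures are mutually singular, so for large \<open>n\<close> these differences span a space of dimension
  \<open>l - 1\<close> in a space of dimension at most \<open>d\<close>.\<close>

text \<open>The rank bounds the number of vertices of a level but not the number of edges into a
  vertex, so the errors of single edges cannot simply be added up: many small errors may exceed 1/2,
  and the sum of the rounded heights would no longer be the rounded sum. The order of the edges
  removes this obstacle. The towers of level \<open>n\<close> are stacked in that order inside a
  tower of level \<open>n + 1\<close>, so every partial sum of heights (\<open>edge_offset\<close>)
  is itself a time between two visits to the union of the bases of level \<open>n\<close>, and
  \<open>\<alpha>\<close> times it is close to an integer. Rounding can then proceed one edge at a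
  time, with two errors below 1/4 in each step. Two passages from limits to a single level shape the
  rest. Singularity makes the ergodic measures independent on Borel sets, and a stabilization
  argument for decreasing spaces of relations brings this down to the bases of one level. In the
  other direction, a rational relation between integer vectors of one level is carried up to all
  higher levels, where the errors vanish and the eigenvalues themselves must satisfy it.\<close>

section \<open>Linear algebra\<close>

text \<open>Gaussian elimination, one equation per induction step: a pivot \<open>u0\<close> with
  nonzero coefficient in equation \<open>e0\<close> is eliminated from the other equations, and its
  value is recovered by substitution into \<open>e0\<close>.\<close>

lemma homogeneous_system_nontrivial:
  fixes A :: "'e \<Rightarrow> 'u \<Rightarrow> 'k::field"
  assumes "finite E" "finite U" "card E < card U"
  shows "\<exists>x. (\<exists>u\<in>U. x u \<noteq> 0) \<and> (\<forall>e\<in>E. (\<Sum>u\<in>U. A e u * x u) = 0)"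
  using assms
proof (induction E arbitrary: U A rule: finite_induct)
  case empty
  then obtain u where "u \<in> U"
    by fastforce
  then show ?case
    by (intro exI[of _ "\<lambda>_. 1"]) auto
next
  case (insert e0 E)
  show ?case
  proof (cases "\<forall>u\<in>U. A e0 u = 0")
    case True
    obtain x where "\<exists>u\<in>U. x u \<noteq> 0" "\<forall>e\<in>E. (\<Sum>u\<in>U. A e u * x u) = 0"
      using insert.IH[of U A] insert.prems insert.hyps by auto
    with True show ?thesis
      by (intro exI[of _ x]) auto
  next
    case False
    then obtain u0 where u0: "u0 \<in> U" "A e0 u0 \<noteq> 0"
      by blast
    define U' where "U' = U - {u0}"
    define A' where "A' e u = A e u - A e u0 / A e0 u0 * A e0 u" for e u
    have "card E < card U'"
      using insert.prems insert.hyps u0 by (simp add: U'_def)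
    then obtain x where x: "\<exists>u\<in>U'. x u \<noteq> 0" "\<forall>e\<in>E. (\<Sum>u\<in>U'. A' e u * x u) = 0"
      using insert.IH[of U' A'] insert.prems by (auto simp: U'_def)
    define s where "s = (\<Sum>u\<in>U'. A e0 u * x u)"
    define y where "y = x(u0 := - s / A e0 u0)"
    have split: "(\<Sum>u\<in>U. A e u * y u) = A e u0 * (- s / A e0 u0) + (\<Sum>u\<in>U'. A e u * x u)" for e
    proof -
      have "(\<Sum>u\<in>U. A e u * y u) = A e u0 * y u0 + (\<Sum>u\<in>U'. A e u * y u)"
        unfolding U'_def by (rule sum.remove) (use insert.prems u0 in auto)
      also have "(\<Sum>u\<in>U'. A e u * y u) = (\<Sum>u\<in>U'. A e u * x u)"
        by (rule sum.cong) (auto simp: y_def U'_def)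
      finally show ?thesis
        by (simp add: y_def)
    qed
    have "(\<Sum>u\<in>U. A e u * y u) = 0" if "e \<in> E" for e
    proof -
      have "0 = (\<Sum>u\<in>U'. A e u * x u - A e u0 / A e0 u0 * (A e0 u * x u))"
        using x(2) that by (simp add: A'_def left_diff_distrib mult.assoc)
      also have "\<dots> = (\<Sum>u\<in>U'. A e u * x u) - A e u0 / A e0 u0 * s"
        by (simp add: sum_subtractf sum_distrib_left s_def)
      finally show ?thesis
        using split[of e] by simp
    qed
    moreover have "(\<Sum>u\<in>U. A e0 u * y u) = 0"
      using split[of e0] u0(2) by (simp add: s_def)
    moreover have "\<exists>u\<in>U. y u \<noteq> 0"
      using x(1) by (auto simp: y_def U'_def)
    ultimately show ?thesis
      by blast
  qed
qed

text \<open>Stated for families rather than sets, so that the indices are what is counted and a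
  repeated vector is a relation. Values outside \<open>V\<close> are irrelevant.\<close>

definition independent_family :: "'v set \<Rightarrow> 'i set \<Rightarrow> ('i \<Rightarrow> 'v \<Rightarrow> real) \<Rightarrow> bool" where
  "independent_family V I k \<longleftrightarrow>
     (\<forall>c. (\<forall>v\<in>V. (\<Sum>i\<in>I. c i * k i v) = 0) \<longrightarrow> (\<forall>i\<in>I. c i = 0))"

text \<open>If \<open>x\<close> is a combination of the \<open>k i\<close> and \<open>- x\<close> one of the \<open>m j\<close>, then \<open>x\<close> is orthogonal
  to itself. So both families together are independent.\<close>

lemma card_orthogonal_families_le:
  fixes k :: "'i \<Rightarrow> 'v \<Rightarrow> real" and m :: "'j \<Rightarrow> 'v \<Rightarrow> real"
  assumes fin: "finite V" "finite I" "finite J"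
    and k: "independent_family V I k" and m: "independent_family V J m"
    and orth: "\<And>i j. i \<in> I \<Longrightarrow> j \<in> J \<Longrightarrow> (\<Sum>v\<in>V. k i v * m j v) = 0"
  shows "card I + card J \<le> card V"
proof (rule ccontr)
  assume "\<not> ?thesis"
  then have "card V < card (I <+> J)"
    using fin by (simp add: card_Plus)
  then obtain x where x: "\<exists>u\<in>I <+> J. x u \<noteq> 0"
    "\<forall>v\<in>V. (\<Sum>u\<in>I <+> J. (case u of Inl i \<Rightarrow> k i v | Inr j \<Rightarrow> m j v) * x u) = 0"
    using homogeneous_system_nontrivial[of V "I <+> J"
        "\<lambda>v u. case u of Inl i \<Rightarrow> k i v | Inr j \<Rightarrow> m j v"] fin by auto
  define a where "a v = (\<Sum>i\<in>I. x (Inl i) * k i v)" for v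
  define b where "b v = (\<Sum>j\<in>J. x (Inr j) * m j v)" for v
  have ab: "a v + b v = 0" if "v \<in> V" for v
    using x(2) that fin by (auto simp: sum.Plus a_def b_def mult.commute)
  have "(\<Sum>v\<in>V. a v * b v) = (\<Sum>v\<in>V. \<Sum>i\<in>I. \<Sum>j\<in>J. x (Inl i) * x (Inr j) * (k i v * m j v))"
    by (simp add: a_def b_def sum_product mult_ac)
  also have "\<dots> = (\<Sum>i\<in>I. \<Sum>j\<in>J. x (Inl i) * x (Inr j) * (\<Sum>v\<in>V. k i v * m j v))"
    by (subst sum.swap, rule sum.cong[OF refl], subst sum.swap) (simp add: sum_distrib_left)
  also have "\<dots> = 0"
    using orth by simp
  finally have "(\<Sum>v\<in>V. a v * a v) = 0"
    using ab by (simp add: eq_neg_iff_add_eq_0[symmetric] sum_negf)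
  then have a0: "\<forall>v\<in>V. a v = 0"
    using fin by (subst (asm) sum_nonneg_eq_0_iff) auto
  then have "\<forall>v\<in>V. b v = 0"
    using ab by auto
  with a0 have "\<forall>i\<in>I. x (Inl i) = 0" "\<forall>j\<in>J. x (Inr j) = 0"
    using k[unfolded independent_family_def, rule_format, of "x \<circ> Inl"]
      m[unfolded independent_family_def, rule_format, of "x \<circ> Inr"]
    by (simp_all add: a_def b_def)
  with x(1) show False
    by auto
qed

text \<open>A relation among the differences becomes one among the \<open>m j\<close> when
  \<open>m j0\<close> receives minus the sum of the coefficients. The one vector lost here is the 1
  in the bound \<open>d - l + 1\<close>.\<close>

lemma independent_family_diff:
  assumes "finite J" "j0 \<in> J" and m: "independent_family V J m"
  shows "independent_family V (J - {j0}) (\<lambda>j v. m j v - m j0 v)"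
  unfolding independent_family_def
proof (intro allI impI)
  fix c :: "'a \<Rightarrow> real"
  assume c: "\<forall>v\<in>V. (\<Sum>j\<in>J - {j0}. c j * (m j v - m j0 v)) = 0"
  define c' where "c' = c(j0 := - (\<Sum>j\<in>J - {j0}. c j))"
  have "(\<Sum>j\<in>J. c' j * m j v) = 0" if "v \<in> V" for v
  proof -
    have "(\<Sum>j\<in>J. c' j * m j v) = c' j0 * m j0 v + (\<Sum>j\<in>J - {j0}. c' j * m j v)"
      by (rule sum.remove) fact+
    also have "(\<Sum>j\<in>J - {j0}. c' j * m j v) = (\<Sum>j\<in>J - {j0}. c j * m j v)"
      by (rule sum.cong) (auto simp: c'_def)
    also have "c' j0 * m j0 v + \<dots> = (\<Sum>j\<in>J - {j0}. c j * (m j v - m j0 v))"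
      by (simp add: c'_def right_diff_distrib sum_subtractf sum_distrib_right)
    finally show ?thesis
      using c that by simp
  qed
  then have "\<forall>j\<in>J. c' j = 0"
    using m unfolding independent_family_def by blast
  then show "\<forall>j\<in>J - {j0}. c j = 0"
    by (metis DiffD1 DiffD2 c'_def fun_upd_other insertCI)
qed

text \<open>An elementary form of the fact that a decreasing sequence of subspaces of a
  finite-dimensional space becomes stationary. The induction is on the set of coordinates allowed to
  be nonzero.\<close>

lemma decreasing_subspaces_trivial:
  fixes K :: "nat \<Rightarrow> ('j \<Rightarrow> real) set"
  assumes "finite J"
    and diff: "\<And>n x y. x \<in> K n \<Longrightarrow> y \<in> K n \<Longrightarrow> (\<lambda>j. x j - y j) \<in> K n"
    and scale: "\<And>n x a. x \<in> K n \<Longrightarrow> (\<lambda>j. a * x j) \<in> K n"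
    and dec: "\<And>n n'. n \<le> n' \<Longrightarrow> K n' \<subseteq> K n"
    and inter: "\<And>x. (\<And>n. x \<in> K n) \<Longrightarrow> (\<forall>j. j \<notin> J \<longrightarrow> x j = 0) \<Longrightarrow> x = (\<lambda>_. 0)"
  shows "\<exists>n. \<forall>x\<in>K n. (\<forall>j. j \<notin> J \<longrightarrow> x j = 0) \<longrightarrow> x = (\<lambda>_. 0)"
  using assms(1) inter
proof (induction J rule: finite_induct)
  case empty
  then show ?case
    by auto
next
  case (insert j0 J)
  have "x = (\<lambda>_. 0)" if "\<And>n. x \<in> K n" "\<forall>j. j \<notin> J \<longrightarrow> x j = 0" for x
    using insert.prems[of x] that by auto
  then obtain N where N: "\<And>x. x \<in> K N \<Longrightarrow> \<forall>j. j \<notin> J \<longrightarrow> x j = 0 \<Longrightarrow> x = (\<lambda>_. 0)"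
    using insert.IH by blast
  show ?case
  proof (rule ccontr)
    assume "\<not> ?thesis"
    then have "\<forall>n. \<exists>x. x \<in> K n \<and> (\<forall>j. j \<notin> insert j0 J \<longrightarrow> x j = 0) \<and> x \<noteq> (\<lambda>_. 0)"
      by auto
    then obtain x where x: "\<And>n. x n \<in> K n" "\<And>n j. j \<notin> insert j0 J \<Longrightarrow> x n j = 0"
      "\<And>n. x n \<noteq> (\<lambda>_. 0)"
      by metis
    have x0: "x n j0 \<noteq> 0" if "n \<ge> N" for n
    proof
      assume "x n j0 = 0"
      then have "\<forall>j. j \<notin> J \<longrightarrow> x n j = 0"
        using x(2) by (metis insertE)
      moreover have "x n \<in> K N"
        using x(1) dec[OF that] by blast
      ultimately show False
        using N x(3) by blast
    qed
    \<comment> \<open>Normalizing the coordinate \<open>j0\<close> to 1 makes the vector unique from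
      \<open>N\<close> on: two such vectors differ by an element of \<open>K N\<close> supported in
      \<open>J\<close>, which is 0. So one nonzero vector lies in every \<open>K n\<close>.\<close>
    define y where "y n = (\<lambda>j. inverse (x n j0) * x n j)" for n
    have y: "y n \<in> K n" "j \<notin> insert j0 J \<Longrightarrow> y n j = 0" for n j
      using x scale by (auto simp: y_def)
    have y1: "y n j0 = 1" if "n \<ge> N" for n
      using x0[OF that] by (simp add: y_def)
    have "y n = y N" if "n \<ge> N" for n
    proof -
      have "(\<lambda>j. y n j - y N j) = (\<lambda>_. 0)"
      proof (rule N)
        show "(\<lambda>j. y n j - y N j) \<in> K N"
          using diff y(1) dec[OF that] by (meson subsetD)
        show "\<forall>j. j \<notin> J \<longrightarrow> y n j - y N j = 0"
          using y y1[OF that] y1[of N] by (metis diff_self insert_iff le_refl)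
      qed
      then show ?thesis
        by (simp add: fun_eq_iff)
    qed
    then have "y N \<in> K n" for n
      using y(1) dec by (metis le_cases subsetD)
    then have "y N = (\<lambda>_. 0)"
      using insert.prems[of "y N"] y by auto
    with y1[of N] show False
      by simp
  qed
qed

section \<open>Rational and real linear relations\<close>

lemma vector_space_rat_real: "vector_space (\<lambda>(q::rat) (x::real). of_rat q * x)"
  by unfold_locales (simp_all add: distrib_left distrib_right of_rat_add of_rat_mult)

lemma rationally_independentD:
  assumes "rationally_independent S" "finite S" "(\<Sum>\<alpha>\<in>S. of_rat (q \<alpha>) * \<alpha>) = 0" "\<alpha> \<in> S"
  shows "q \<alpha> = 0"
proof -
  interpret vector_space "\<lambda>(q::rat) (x::real). of_rat q * x"
    by (rule vector_space_rat_real)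
  show ?thesis
    using assms unfolding rationally_independent_def
    by (auto simp: dependent_finite)
qed

text \<open>Apply to the real solution a \<open>\<rat>\<close>-linear functional that maps one of its nonzero entries
  to \<open>1\<close>.\<close>

lemma rational_solution_of_real_solution:
  fixes k :: "'i \<Rightarrow> 'v \<Rightarrow> int" and a :: "'i \<Rightarrow> real"
  assumes "a i0 \<noteq> 0" "\<And>v. v \<in> V \<Longrightarrow> (\<Sum>i\<in>I. a i * of_int (k i v)) = 0"
  obtains q :: "'i \<Rightarrow> rat" where "q i0 = 1" "\<And>v. v \<in> V \<Longrightarrow> (\<Sum>i\<in>I. q i * of_int (k i v)) = 0"
proof -
  interpret vector_space_pair "\<lambda>(q::rat) (x::real). of_rat q * x" "(*) :: rat \<Rightarrow> rat \<Rightarrow> rat"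
    by (simp add: vector_space_pair_def vector_space_rat_real)
      (unfold_locales, simp_all add: distrib_left distrib_right)
  have "vs1.independent {a i0}"
    using assms(1) by (simp add: vs1.dependent_single)
  then obtain g where g: "Vector_Spaces.linear (\<lambda>q x. of_rat q * x) (*) g" "g (a i0) = 1"
    using linear_independent_extend[of "{a i0}" "\<lambda>_. 1"] by auto
  interpret g: Vector_Spaces.linear "\<lambda>q x. of_rat q * x" "(*)" g
    by (rule g(1))
  have "(\<Sum>i\<in>I. g (a i) * of_int (k i v)) = 0" if "v \<in> V" for v
  proof -
    have "(\<Sum>i\<in>I. g (a i) * of_int (k i v)) = (\<Sum>i\<in>I. g (of_rat (of_int (k i v)) * a i))"
      by (simp only: g.scale mult.commute[of "g _"])
    also have "\<dots> = g (\<Sum>i\<in>I. a i * of_int (k i v))"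
      by (simp add: g.sum mult.commute)
    finally show ?thesis
      using assms(2)[OF that] g.zero by simp
  qed
  then show ?thesis
    using g(2) by (intro that[of "\<lambda>i. g (a i)"])
qed

section \<open>Distance to the nearest integer\<close>

text \<open>The signed rounding error takes the place of \<open>frac\<close>, which jumps exactly at
  the integers, where the multiples under study accumulate.\<close>

definition near_frac :: "real \<Rightarrow> real" where
  "near_frac t = t - of_int (round t)"

lemma abs_near_frac_le: "\<bar>near_frac t\<bar> \<le> 1 / 2"
  using of_int_round_abs_le[of t] unfolding near_frac_def by linarith

lemma exp_near_frac:
  "exp (2 * \<i> * complex_of_real pi * complex_of_real (near_frac t)) =
   exp (2 * \<i> * complex_of_real pi * complex_of_real t)"
proof -
  have "exp (2 * \<i> * complex_of_real pi * complex_of_real (near_frac t)) =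
    exp (2 * \<i> * complex_of_real pi * complex_of_real t - complex_of_real (2 * of_int (round t) * pi) * \<i>)"
    by (simp add: near_frac_def algebra_simps)
  also have "\<dots> = exp (2 * \<i> * complex_of_real pi * complex_of_real t)"
    unfolding exp_diff using exp_integer_2pi[of "of_int (round t)"]
    by simp
  finally show ?thesis .
qed

text \<open>By periodicity \<open>t\<close> may be replaced by \<open>near_frac t\<close>, which
  lies in \<open>[-1/2, 1/2]\<close>. On the compact part \<open>K\<close> of that interval away
  from 0 the norm is continuous and positive, so it has a positive minimum.\<close>

lemma near_frac_small:
  assumes "e > 0"
  obtains r where "r > 0"
    "\<And>t. norm (exp (2 * \<i> * complex_of_real pi * complex_of_real t) - 1) < r \<Longrightarrow> \<bar>near_frac t\<bar> < e"
proof -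
  define g where "g s = norm (exp (2 * \<i> * complex_of_real pi * complex_of_real s) - 1)" for s
  define K where "K = {s::real. \<bar>s\<bar> \<le> 1 / 2 \<and> \<bar>s\<bar> \<ge> e}"
  have "K = cball 0 (1/2) - ball 0 e"
    by (auto simp: K_def)
  then have "compact K"
    by (simp add: compact_diff)
  have pos: "g s > 0" if "s \<in> K" for s
  proof (rule ccontr)
    assume "\<not> g s > 0"
    then have "exp (2 * \<i> * complex_of_real pi * complex_of_real s) = 1"
      by (simp add: g_def)
    then obtain n :: int where "2 * pi * s = of_int (2 * n) * pi"
      by (auto simp: exp_eq_1)
    then have "s = of_int n"
      by simp
    moreover have "\<bar>s\<bar> \<le> 1 / 2" "s \<noteq> 0"
      using that assms by (auto simp: K_def)
    ultimately show False
      by (cases "n = 0") (simp_all flip: of_int_abs)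
  qed
  have "\<exists>r>0. \<forall>s\<in>K. r \<le> g s"
  proof (cases "K = {}")
    case False
    have "continuous_on K g"
      unfolding g_def by (intro continuous_intros)
    then obtain s where "s \<in> K" "\<forall>s'\<in>K. g s \<le> g s'"
      using continuous_attains_inf[OF \<open>compact K\<close> False] by blast
    with pos show ?thesis
      by blast
  qed (auto intro: exI[of _ 1])
  then obtain r where r: "r > 0" "\<forall>s\<in>K. r \<le> g s"
    by blast
  show ?thesis
  proof (rule that[OF r(1)])
    fix t
    assume "norm (exp (2 * \<i> * complex_of_real pi * complex_of_real t) - 1) < r"
    then have "near_frac t \<notin> K"
      using r(2) exp_near_frac[of t] unfolding g_def by force
    then show "\<bar>near_frac t\<bar> < e"
      using abs_near_frac_le[of t] by (auto simp: K_def)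
  qed
qed

text \<open>The two errors add up to less than 1/2, which determines the nearest integer. This is
  the origin of the tolerance 1/4 in the transport of rounded heights.\<close>

lemma round_add:
  assumes "\<bar>near_frac a\<bar> < 1 / 4" "\<bar>near_frac b\<bar> < 1 / 4"
  shows "round (a + b) = round a + round b"
proof (rule round_unique')
  show "\<bar>a + b - of_int (round a + round b)\<bar> < 1 / 2"
    using assms unfolding near_frac_def of_int_add by linarith
qed

section \<open>Ergodic measures\<close>

lemma sets_invariant_measure:
  "invariant_measure X T M \<Longrightarrow> sets M = sigma_sets (topspace X) {U. openin X U}"
  by (simp add: invariant_measure_def)

lemma space_invariant_measure: "invariant_measure X T M \<Longrightarrow> space M = topspace X"
  by (simp add: invariant_measure_def)

lemma openin_in_sets: "invariant_measure X T M \<Longrightarrow> openin X U \<Longrightarrow> U \<in> sets M"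
  by (auto simp: invariant_measure_def)

lemma continuous_vimage_in_sets:
  assumes M: "invariant_measure X T M" and f: "continuous_map X X f" and A: "A \<in> sets M"
  shows "f -` A \<inter> topspace X \<in> sets M"
proof -
  have "f \<in> measurable M M"
  proof (rule measurable_sigma_sets[OF sets_invariant_measure[OF M]])
    show "{U. openin X U} \<subseteq> Pow (topspace X)"
      by (auto dest: openin_subset)
    show "f \<in> space M \<rightarrow> topspace X"
      using f by (auto simp: space_invariant_measure[OF M] continuous_map_def)
    show "f -` U \<inter> space M \<in> sets M" if "U \<in> {U. openin X U}" for U
    proof -
      have "f -` U \<inter> space M = {x \<in> topspace X. f x \<in> U}"
        by (auto simp: space_invariant_measure[OF M])
      then show ?thesis
        using f that openin_in_sets[OF M] by (simp add: continuous_map_def)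
    qed
  qed
  then show ?thesis
    using A space_invariant_measure[OF M] by (auto dest: measurable_sets)
qed

text \<open>The invariant hull of a Hahn set is formed with translates in both directions, so the
  domination argument is applied to the inverse map as well.\<close>

lemma invariant_measure_inverse:
  assumes M: "invariant_measure X T M" and T: "homeomorphic_maps X X T T'"
  shows "invariant_measure X T' M"
proof -
  have "emeasure M (T' -` A \<inter> space M) = emeasure M A" if "A \<in> sets M" for A
  proof -
    have "T' -` A \<inter> topspace X \<in> sets M"
      using continuous_vimage_in_sets[OF M _ that] T by (simp add: homeomorphic_maps_def)
    then have "emeasure M (T' -` A \<inter> topspace X) =
        emeasure M (T -` (T' -` A \<inter> topspace X) \<inter> topspace X)"
      using M by (metis invariant_measure_def)
    also have "T -` (T' -` A \<inter> topspace X) \<inter> topspace X = A"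
      using T sets.sets_into_space[OF that] space_invariant_measure[OF M]
      by (auto simp: homeomorphic_maps_def continuous_map_def)
    finally show ?thesis
      using space_invariant_measure[OF M] by simp
  qed
  with M show ?thesis
    by (auto simp: invariant_measure_def)
qed

text \<open>Positivity of the set \<open>A\<close> for the signed measure \<open>M - N\<close>,
  expressed without signed measures.\<close>

definition dominated_on :: "'a measure \<Rightarrow> 'a measure \<Rightarrow> 'a set \<Rightarrow> bool" where
  "dominated_on N M A \<longleftrightarrow> A \<in> sets M \<and> (\<forall>B\<in>sets M. B \<subseteq> A \<longrightarrow> emeasure N B \<le> emeasure M B)"

text \<open>A subset of the union is cut along the disjointed sequence into pieces that each lie in
  one \<open>A n\<close>, and their inequalities are summed.\<close>

lemma dominated_on_UN:
  assumes dom: "\<And>n::nat. dominated_on N M (A n)" and sets: "sets N = sets M"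
  shows "dominated_on N M (\<Union>n. A n)"
  unfolding dominated_on_def
proof (intro conjI ballI impI)
  show "(\<Union>n. A n) \<in> sets M"
    using dom by (auto simp: dominated_on_def)
  fix B assume B: "B \<in> sets M" "B \<subseteq> (\<Union>n. A n)"
  have A: "range A \<subseteq> sets M"
    using dom by (auto simp: dominated_on_def)
  define D where "D n = B \<inter> disjointed A n" for n
  have D: "range D \<subseteq> sets M"
    using B(1) sets.range_disjointed_sets[OF A] by (auto simp: D_def)
  have disj: "disjoint_family D"
    using disjoint_family_disjointed[of A] by (auto simp: D_def disjoint_family_on_def)
  have "(\<Union>n. D n) = B"
    using B(2) UN_disjointed_eq[of A] by (auto simp: D_def)
  then have "emeasure N B = (\<Sum>n. emeasure N (D n))" "emeasure M B = (\<Sum>n. emeasure M (D n))"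
    using suminf_emeasure[OF D disj] suminf_emeasure[of D N] D disj sets by auto
  moreover have "emeasure N (D n) \<le> emeasure M (D n)" for n
  proof -
    have "D n \<in> sets M" "D n \<subseteq> A n"
      using D disjointed_subset[of A n] by (auto simp: D_def)
    then show ?thesis
      using dom[of n] by (simp add: dominated_on_def)
  qed
  ultimately show "emeasure N B \<le> emeasure M B"
    by (auto intro: suminf_le)
qed

lemma dominated_on_vimage:
  assumes M: "invariant_measure X T M" and N: "invariant_measure X T N"
    and T: "homeomorphic_maps X X T T'" and A: "dominated_on N M A"
  shows "dominated_on N M (T -` A \<inter> topspace X)"
  unfolding dominated_on_def
proof (intro conjI ballI impI)
  show "T -` A \<inter> topspace X \<in> sets M"
    using continuous_vimage_in_sets[OF M] T A by (simp add: homeomorphic_maps_def dominated_on_def)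
  fix B assume B: "B \<in> sets M" "B \<subseteq> T -` A \<inter> topspace X"
  have sets: "sets N = sets M"
    using M N by (simp add: invariant_measure_def)
  define C where "C = T' -` B \<inter> topspace X"
  have C: "C \<in> sets M"
    using continuous_vimage_in_sets[OF M _ B(1)] T by (simp add: homeomorphic_maps_def C_def)
  have "C \<subseteq> A"
    using B(2) T by (auto simp: C_def homeomorphic_maps_def)
  have "T -` C \<inter> topspace X = B"
    using B(2) T by (auto simp: C_def homeomorphic_maps_def continuous_map_def)
  then have "emeasure N B = emeasure N C" "emeasure M B = emeasure M C"
    using M N C sets by (force simp: invariant_measure_def)+
  then show "emeasure N B \<le> emeasure M B"
    using A C \<open>C \<subseteq> A\<close> by (auto simp: dominated_on_def)
qed

text \<open>Since both total masses are 1, the inequality for the complement is the reverse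
  inequality.\<close>

lemma prob_space_dominated_eq:
  assumes "prob_space M" "prob_space N" and sets: "sets N = sets M"
    and le: "\<And>A. A \<in> sets M \<Longrightarrow> measure N A \<le> measure M A"
  shows "M = N"
proof (rule measure_eqI)
  interpret M: prob_space M by fact
  interpret N: prob_space N by fact
  show "sets M = sets N"
    using sets by simp
  fix A assume A: "A \<in> sets M"
  have "measure N (space M - A) \<le> measure M (space M - A)"
    using A by (intro le) auto
  then have "measure M A \<le> measure N A"
    using M.prob_compl[OF A] N.prob_compl[of A] A sets sets_eq_imp_space_eq[OF sets] by simp
  with le[OF A] show "emeasure M A = emeasure N A"
    by (simp add: M.emeasure_eq_measure N.emeasure_eq_measure)
qed

text \<open>The union of all translates of the positive set of a Hahn decomposition of \<open>M - N\<close> is again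
  such a positive set, and it is invariant.\<close>

lemma ergodic_measures_singular:
  assumes T: "homeomorphic_map X X T" and M: "M \<in> ergodic_measures X T"
    and N: "N \<in> ergodic_measures X T" and ne: "M \<noteq> N"
  obtains A where "A \<in> sets M" "measure M A = 1" "measure N A = 0"
proof -
  obtain T' where T': "homeomorphic_maps X X T T'"
    using T homeomorphic_map_maps by blast
  have T'': "homeomorphic_maps X X T' T"
    using T' homeomorphic_maps_sym by blast
  have iM: "invariant_measure X T M" and iN: "invariant_measure X T N"
    using M N by (auto simp: ergodic_measures_def)
  interpret M: prob_space M
    using iM by (simp add: invariant_measure_def)
  interpret N: prob_space N
    using iN by (simp add: invariant_measure_def)
  have sets: "sets N = sets M" and space: "space M = topspace X" "space N = topspace X"
    using iM iN by (simp_all add: invariant_measure_def)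
  have "finite_measure M" "finite_measure N"
    by unfold_locales
  then obtain Y where Y: "Y \<in> sets M" "\<forall>A\<in>sets M. A \<subseteq> Y \<longrightarrow> emeasure N A \<le> emeasure M A"
    "\<forall>A\<in>sets M. A \<inter> Y = {} \<longrightarrow> emeasure M A \<le> emeasure N A"
    using finite_unsigned_Hahn_decomposition[of M N] sets by blast
  define F where "F n = (T ^^ n) -` Y \<inter> topspace X" for n
  define G where "G n = (T' ^^ n) -` Y \<inter> topspace X" for n
  have YX: "Y \<subseteq> topspace X"
    using Y(1) sets.sets_into_space space by blast
  have mapsT: "T x \<in> topspace X" "T' x \<in> topspace X" "T' (T x) = x" "T (T' x) = x"
    if "x \<in> topspace X" for x
    using T' that by (auto simp: homeomorphic_maps_def continuous_map_def)
  have F: "dominated_on N M (F n)" for n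
  proof (induction n)
    case 0
    then show ?case
      using Y YX by (simp add: F_def dominated_on_def Int_absorb2)
  next
    case (Suc n)
    have "F (Suc n) = T -` F n \<inter> topspace X"
      using mapsT by (auto simp: F_def funpow_swap1)
    then show ?case
      using dominated_on_vimage[OF iM iN T' Suc] by simp
  qed
  have G: "dominated_on N M (G n)" for n
  proof (induction n)
    case 0
    then show ?case
      using Y YX by (simp add: G_def dominated_on_def Int_absorb2)
  next
    case (Suc n)
    have "G (Suc n) = T' -` G n \<inter> topspace X"
      using mapsT by (auto simp: G_def funpow_swap1)
    then show ?case
      using dominated_on_vimage[OF _ _ T'' Suc] invariant_measure_inverse[OF _ T'] iM iN by simp
  qed
  \<comment> \<open>The dummy index \<open>m\<close> selects forward or backward translates, so that
    two applications of \<open>dominated_on_UN\<close> treat both kinds.\<close>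
  define Z where "Z = (\<Union>n. \<Union>m::nat. if m = 0 then F n else G n)"
  have Z_iff: "x \<in> Z \<longleftrightarrow> x \<in> topspace X \<and> (\<exists>n. (T ^^ n) x \<in> Y \<or> (T' ^^ n) x \<in> Y)" for x
    by (auto simp: Z_def F_def G_def split: if_splits)
  have Z: "dominated_on N M Z"
    unfolding Z_def by (intro dominated_on_UN) (use F G sets in auto)
  then have Zs: "Z \<in> sets M"
    by (simp add: dominated_on_def)
  have neg: "emeasure M A \<le> emeasure N A" if "A \<in> sets M" "A \<inter> Z = {}" for A
  proof -
    have "Y \<subseteq> Z"
      using Z_iff YX by (metis funpow_0 subset_iff)
    then show ?thesis
      using Y(3) that by blast
  qed
  have "T -` Z \<inter> topspace X = Z"
  proof (intro equalityI subsetI)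
    fix x assume "x \<in> T -` Z \<inter> topspace X"
    then obtain n where x: "x \<in> topspace X" and n: "(T ^^ n) (T x) \<in> Y \<or> (T' ^^ n) (T x) \<in> Y"
      by (auto simp: Z_iff)
    show "x \<in> Z"
    proof (cases "(T ^^ n) (T x) \<in> Y")
      case True
      then have "(T ^^ Suc n) x \<in> Y"
        by (simp add: funpow_swap1)
      with x show ?thesis
        using Z_iff by blast
    next
      case False
      show ?thesis
      proof (cases n)
        case 0
        with n have "(T ^^ 1) x \<in> Y"
          by simp
        with x show ?thesis
          using Z_iff by blast
      next
        case (Suc k)
        with n False have "(T' ^^ k) x \<in> Y"
          using mapsT(3)[OF x] by (simp add: funpow_swap1)
        with x show ?thesis
          using Z_iff by blast
      qed
    qed
  next
    fix x assume "x \<in> Z"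
    then obtain n where x: "x \<in> topspace X" and n: "(T ^^ n) x \<in> Y \<or> (T' ^^ n) x \<in> Y"
      by (auto simp: Z_iff)
    have Tx: "T x \<in> topspace X"
      using mapsT x by blast
    have "\<exists>n. (T ^^ n) (T x) \<in> Y \<or> (T' ^^ n) (T x) \<in> Y"
    proof (cases "(T' ^^ n) x \<in> Y")
      case True
      then have "(T' ^^ Suc n) (T x) \<in> Y"
        using mapsT(3)[OF x] by (simp add: funpow_swap1)
      then show ?thesis
        by blast
    next
      case False
      show ?thesis
      proof (cases n)
        case 0
        with n have "(T' ^^ 1) (T x) \<in> Y"
          using mapsT(3)[OF x] by simp
        then show ?thesis
          by blast
      next
        case (Suc k)
        with n False have "(T ^^ k) (T x) \<in> Y"
          by (simp add: funpow_swap1)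
        then show ?thesis
          by blast
      qed
    qed
    with x Tx show "x \<in> T -` Z \<inter> topspace X"
      by (simp add: Z_iff)
  qed
  then have M01: "measure M Z = 0 \<or> measure M Z = 1" and N01: "measure N Z = 0 \<or> measure N Z = 1"
    using M N Zs sets space by (auto simp: ergodic_measures_def measure_def)
  have le: "measure N A \<le> measure M A" if "A \<in> sets M" "A \<subseteq> Z" for A
    using Z that by (auto simp: dominated_on_def M.emeasure_eq_measure N.emeasure_eq_measure)
  have ge: "measure M A \<le> measure N A" if "A \<in> sets M" "A \<inter> Z = {}" for A
    using neg[OF that] by (auto simp: M.emeasure_eq_measure N.emeasure_eq_measure)
  have splitM: "measure M A = measure M (A \<inter> Z) + measure M (A - Z)" if "A \<in> sets M" for A
    using M.finite_measure_Union[of "A \<inter> Z" "A - Z"] that Zs by (simp add: Int_Diff_Un disjoint_iff)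
  have splitN: "measure N A = measure N (A \<inter> Z) + measure N (A - Z)" if "A \<in> sets M" for A
    using N.finite_measure_Union[of "A \<inter> Z" "A - Z"] that Zs sets by (simp add: Int_Diff_Un disjoint_iff)
  have "measure M Z = 1 \<and> measure N Z = 0"
  proof (rule ccontr)
    assume "\<not> ?thesis"
    \<comment> \<open>\<open>le\<close> excludes the mixed case. In the two cases left, the
      domination on whichever of \<open>Z\<close> and its complement carries all the mass extends to
      all measurable sets.\<close>
    then consider "measure M Z = 0" "measure N Z = 0" | "measure M Z = 1" "measure N Z = 1"
      using M01 N01 le[OF Zs] by auto
    then have "M = N"
    proof cases
      case 1
      have "measure M A \<le> measure N A" if "A \<in> sets M" for A
      proof -
        have "measure M (A \<inter> Z) \<le> measure M Z"
          using that Zs by (intro M.finite_measure_mono) auto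
        moreover have "measure M (A - Z) \<le> measure N (A - Z)"
          using that Zs by (intro ge) auto
        ultimately show ?thesis
          using 1 splitM[OF that] splitN[OF that] measure_nonneg[of N "A \<inter> Z"] by linarith
      qed
      then show ?thesis
        using prob_space_dominated_eq[OF N.prob_space_axioms M.prob_space_axioms] sets by auto
    next
      case 2
      have "measure N A \<le> measure M A" if "A \<in> sets M" for A
      proof -
        have "measure N (A - Z) \<le> measure N (space N - Z)"
          using that Zs sets sets.sets_into_space[OF that] space sets.compl_sets[of Z N]
          by (intro N.finite_measure_mono) auto
        moreover have "measure N (space N - Z) = 0"
          using N.prob_compl[of Z] 2 Zs sets by simp
        moreover have "measure N (A \<inter> Z) \<le> measure M (A \<inter> Z)"
          using that Zs by (intro le) auto
        ultimately show ?thesis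
          using splitM[OF that] splitN[OF that] measure_nonneg[of M "A - Z"] by linarith
      qed
      then show ?thesis
        using prob_space_dominated_eq[OF M.prob_space_axioms N.prob_space_axioms] sets by auto
    qed
    with ne show False
      by simp
  qed
  with Zs that show ?thesis
    by blast
qed

text \<open>The finitely many sets separating \<open>M\<close> from the other measures intersect in
  a set \<open>D\<close> that has mass 1 for \<open>M\<close> and 0 for the others. On
  \<open>D\<close> the relation reduces to \<open>c M\<close>.\<close>

lemma ergodic_measures_independent:
  assumes T: "homeomorphic_map X X T" and J: "finite J" "J \<subseteq> ergodic_measures X T"
    and c: "\<And>A. A \<in> sigma_sets (topspace X) {U. openin X U} \<Longrightarrow> (\<Sum>M\<in>J. c M * measure M A) = 0"
    and M: "M \<in> J"
  shows "c M = 0"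
proof -
  have iM: "invariant_measure X T M" and eM: "M \<in> ergodic_measures X T"
    using J M by (auto simp: ergodic_measures_def)
  have sets: "sets N = sets M" if "N \<in> J" for N
    using J that iM by (auto simp: ergodic_measures_def invariant_measure_def)
  interpret M: prob_space M
    using iM by (simp add: invariant_measure_def)
  have "\<exists>A. A \<in> sets M \<and> measure M A = 1 \<and> measure N A = 0" if "N \<in> J - {M}" for N
    using ergodic_measures_singular[OF T eM, of N] that J by blast
  then obtain A where A: "\<And>N. N \<in> J - {M} \<Longrightarrow> A N \<in> sets M \<and> measure M (A N) = 1 \<and> measure N (A N) = 0"
    by metis
  \<comment> \<open>The factor \<open>space M\<close> makes \<open>D\<close> the whole space when
    \<open>J = {M}\<close>, where the intersection over the empty family would be
    \<open>UNIV\<close>.\<close>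
  define D where "D = space M \<inter> (\<Inter>N\<in>J - {M}. A N)"
  have D: "D \<in> sets M"
  proof (cases "J - {M} = {}")
    case False
    then show ?thesis
      unfolding D_def using A J by (intro sets.Int sets.finite_INT) auto
  next
    case True
    then show ?thesis
      unfolding D_def True by simp
  qed
  have "AE x in M. \<forall>N\<in>J - {M}. x \<in> A N"
    using J A M.AE_in_set_eq_1 by (intro AE_finite_allI) auto
  with AE_space have "AE x in M. x \<in> D"
    by eventually_elim (auto simp: D_def)
  then have D1: "measure M D = 1"
    using M.AE_in_set_eq_1[OF D] by simp
  have D0: "measure N D = 0" if "N \<in> J - {M}" for N
  proof -
    interpret N: prob_space N
      using that J by (auto simp: ergodic_measures_def invariant_measure_def)
    have "measure N D \<le> measure N (A N)"
      using that A[OF that] sets[of N] by (intro N.finite_measure_mono) (auto simp: D_def)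
    with A[OF that] show ?thesis
      using measure_nonneg[of N D] by simp
  qed
  have "0 = (\<Sum>N\<in>J. c N * measure N D)"
    using c D sets_invariant_measure[OF iM] by simp
  also have "\<dots> = c M * measure M D + (\<Sum>N\<in>J - {M}. c N * measure N D)"
    by (rule sum.remove) (use J M in auto)
  also have "\<dots> = c M"
    using D0 D1 by simp
  finally show ?thesis
    by simp
qed

text \<open>Dynkin's argument for the signed measure with weights \<open>c\<close>; the vanishing
  total mass is what handles complements.\<close>

lemma sum_measure_eq_0_sigma_sets:
  assumes G: "Int_stable G" "G \<subseteq> Pow \<Omega>"
    and J: "\<And>M. M \<in> J \<Longrightarrow> prob_space M \<and> space M = \<Omega> \<and> sets M = sigma_sets \<Omega> G"
    and basic: "\<And>A. A \<in> G \<Longrightarrow> (\<Sum>M\<in>J. c M * measure M A) = 0"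
    and total: "(\<Sum>M\<in>J. c M) = (0::real)"
    and A: "A \<in> sigma_sets \<Omega> G"
  shows "(\<Sum>M\<in>J. c M * measure M A) = 0"
  using G A
proof (induction rule: sigma_sets_induct_disjoint)
  case (basic A)
  then show ?case
    using assms(4) by simp
next
  case empty
  then show ?case
    by simp
next
  case (compl A)
  have "(\<Sum>M\<in>J. c M * measure M (\<Omega> - A)) = (\<Sum>M\<in>J. c M - c M * measure M A)"
  proof (rule sum.cong[OF refl])
    fix M assume "M \<in> J"
    then interpret prob_space M
      using J by blast
    show "c M * measure M (\<Omega> - A) = c M - c M * measure M A"
      using prob_compl[of A] J[OF \<open>M \<in> J\<close>] compl(1) by (simp add: right_diff_distrib)
  qed
  then show ?case
    using compl total by (simp add: sum_subtractf)
next
  case (union A)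
  have "(\<lambda>i. \<Sum>M\<in>J. c M * measure M (A i)) sums (\<Sum>M\<in>J. c M * measure M (\<Union>i. A i))"
  proof (intro sums_sum sums_mult)
    fix M assume "M \<in> J"
    then interpret prob_space M
      using J by blast
    show "(\<lambda>i. measure M (A i)) sums measure M (\<Union>i. A i)"
      using union J[OF \<open>M \<in> J\<close>] by (intro finite_measure_UNION) auto
  qed
  then show ?case
    using union sums_unique2 sums_zero by (metis (no_types, lifting) sums_cong)
qed

section \<open>Properly ordered Bratteli diagrams\<close>

text \<open>Totality with \<open>a = b\<close> supplies reflexivity. Applied to the converse of the
  edge order, the lemma also yields greatest elements.\<close>

lemma finite_total_least:
  assumes "finite U" "U \<noteq> {}" "trans r" "\<And>a b. a \<in> U \<Longrightarrow> b \<in> U \<Longrightarrow> (a, b) \<in> r \<or> (b, a) \<in> r"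
  shows "\<exists>a\<in>U. \<forall>b\<in>U. (a, b) \<in> r"
  using assms
proof (induction U rule: finite_ne_induct)
  case (singleton a)
  then show ?case
    by auto
next
  case (insert a U)
  then obtain b where b: "b \<in> U" "\<forall>c\<in>U. (b, c) \<in> r"
    by blast
  have "(a, a) \<in> r" "(a, b) \<in> r \<or> (b, a) \<in> r"
    using insert.prems(2) b(1) by auto
  then show ?case
    using b transD[OF insert.prems(1), of a b] by blast
qed

locale properly_ordered_diagram =
  fixes B :: "('e, 'z) bratteli_diagram_scheme"
  assumes proper: "properly_ordered B"
begin

lemma ordered: "ordered_bratteli_diagram B"
  using proper by (simp add: properly_ordered_def)

lemma edge_order_partial: "partial_order_on (all_edges B) (edge_order B)"
  using ordered unfolding ordered_bratteli_diagram_def by (elim conjE) assumption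

lemma edge_order_trans: "trans (edge_order B)"
  and edge_order_antisym: "(e, f) \<in> edge_order B \<Longrightarrow> (f, e) \<in> edge_order B \<Longrightarrow> e = f"
  and edge_order_all_edges: "(e, f) \<in> edge_order B \<Longrightarrow> e \<in> all_edges B \<and> f \<in> all_edges B"
  using edge_order_partial
  by (auto simp: partial_order_on_def preorder_on_def antisym_def)

lemma edge_order_comparable:
  assumes "e \<in> all_edges B" "f \<in> all_edges B"
  shows "(e, f) \<in> edge_order B \<or> (f, e) \<in> edge_order B \<longleftrightarrow> end_pt B e = end_pt B f"
proof -
  have "\<forall>e\<in>all_edges B. \<forall>f\<in>all_edges B.
        ((e, f) \<in> edge_order B \<or> (f, e) \<in> edge_order B) \<longleftrightarrow> end_pt B e = end_pt B f"
    using ordered unfolding ordered_bratteli_diagram_def by (elim conjE) assumption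
  with assms show ?thesis
    by blast
qed

lemma edge_order_end_pt: "(e, f) \<in> edge_order B \<Longrightarrow> end_pt B e = end_pt B f"
  using edge_order_comparable edge_order_all_edges by blast

lemma edge_order_total:
  "e \<in> all_edges B \<Longrightarrow> f \<in> all_edges B \<Longrightarrow> end_pt B e = end_pt B f \<Longrightarrow>
    (e, f) \<in> edge_order B \<or> (f, e) \<in> edge_order B"
  using edge_order_comparable by blast

lemma all_edges_iff: "e \<in> all_edges B \<longleftrightarrow> (\<exists>n. e \<in> edges B (Suc n))"
proof
  assume "e \<in> all_edges B"
  then obtain n where "n \<ge> 1" "e \<in> edges B n"
    by (auto simp: all_edges_def)
  then show "\<exists>n. e \<in> edges B (Suc n)"
    by (cases n) auto
qed (auto simp: all_edges_def)

lemma
  assumes "e \<in> edges B (Suc n)"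
  shows init_pt_in: "init_pt B e \<in> vertices B n" and end_pt_in: "end_pt B e \<in> vertices B (Suc n)"
proof -
  have "\<forall>n\<ge>1. \<forall>e\<in>edges B n. init_pt B e \<in> vertices B (n - 1) \<and> end_pt B e \<in> vertices B n"
    using ordered unfolding ordered_bratteli_diagram_def by (elim conjE) assumption
  from this[rule_format, of "Suc n" e] assms
  show "init_pt B e \<in> vertices B n" "end_pt B e \<in> vertices B (Suc n)"
    by simp_all
qed

lemma finite_edges: "finite (edges B (Suc n))"
proof -
  have "\<forall>n\<ge>1. finite (edges B n)"
    using ordered unfolding ordered_bratteli_diagram_def by (elim conjE) assumption
  then show ?thesis
    by simp
qed

lemma ex_edge_from:
  assumes "v \<in> vertices B n"
  shows "\<exists>e\<in>edges B (Suc n). init_pt B e = v"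
proof -
  have "\<forall>n. \<forall>v\<in>vertices B n. \<exists>e\<in>edges B (n + 1). init_pt B e = v"
    using ordered unfolding ordered_bratteli_diagram_def by (elim conjE) assumption
  from this[rule_format, OF assms] show ?thesis
    by simp
qed

lemma ex_edge_into:
  assumes "v \<in> vertices B (Suc n)"
  shows "\<exists>e\<in>edges B (Suc n). end_pt B e = v"
proof -
  have "\<forall>n\<ge>1. \<forall>v\<in>vertices B n. \<exists>e\<in>edges B n. end_pt B e = v"
    using ordered unfolding ordered_bratteli_diagram_def by (elim conjE) assumption
  from this[rule_format, OF _ assms] show ?thesis
    by simp
qed

lemma finite_vertices: "finite (vertices B n)"
  by (simp add: vertices_def)

lemma same_end_pt_level:
  assumes "e \<in> all_edges B" "f \<in> edges B (Suc n)" "end_pt B e = end_pt B f"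
  shows "e \<in> edges B (Suc n)"
proof -
  obtain m where m: "e \<in> edges B (Suc m)"
    using assms(1) all_edges_iff by blast
  have "end_pt B e \<in> vertices B (Suc m)" "end_pt B e \<in> vertices B (Suc n)"
    using end_pt_in[OF m] end_pt_in[OF assms(2)] assms(3) by simp_all
  then have "m = n"
    by (auto simp: vertices_def)
  with m show ?thesis
    by simp
qed

section \<open>The finite linear order on the edges into a vertex\<close>

definition below :: "'e \<Rightarrow> 'e set" where
  "below e = {f. (f, e) \<in> edge_order B \<and> f \<noteq> e}"

definition edges_into :: "nat \<times> nat \<Rightarrow> 'e set" where
  "edges_into v = {e \<in> all_edges B. end_pt B e = v}"

lemma edges_into_level: "v \<in> vertices B (Suc n) \<Longrightarrow> edges_into v = {e \<in> edges B (Suc n). end_pt B e = v}"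
proof -
  assume "v \<in> vertices B (Suc n)"
  then obtain f where "f \<in> edges B (Suc n)" "end_pt B f = v"
    using ex_edge_into by blast
  then show ?thesis
    using same_end_pt_level[of _ f n] all_edges_iff by (auto simp: edges_into_def)
qed

lemma finite_edges_into: "v \<in> vertices B (Suc n) \<Longrightarrow> finite (edges_into v)"
  using finite_edges by (simp add: edges_into_level)

lemma below_subset: "below e \<subseteq> edges_into (end_pt B e)"
  using edge_order_all_edges edge_order_end_pt by (auto simp: below_def edges_into_def)

lemma below_level: "e \<in> edges B (Suc n) \<Longrightarrow> f \<in> below e \<Longrightarrow> f \<in> edges B (Suc n)"
  using below_subset[of e] edges_into_level[OF end_pt_in, of e n] by blast

lemma finite_below: "e \<in> edges B (Suc n) \<Longrightarrow> finite (below e)"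
  by (rule finite_subset[OF below_subset finite_edges_into[OF end_pt_in]])

lemma below_minimal_edge: "minimal_edge B e \<longleftrightarrow> below e = {}"
  by (auto simp: minimal_edge_def below_def)

lemma below_trans: "f \<in> below e \<Longrightarrow> insert f (below f) \<subseteq> below e"
  using edge_order_antisym by (auto simp: below_def intro: transD[OF edge_order_trans])

lemma edges_into_maximal_edge:
  assumes "e \<in> edges B (Suc n)" "maximal_edge B e"
  shows "edges_into (end_pt B e) = insert e (below e)" "e \<notin> below e"
proof -
  have e: "e \<in> all_edges B"
    using assms(1) all_edges_iff by blast
  then have "f \<in> below e" if "f \<in> edges_into (end_pt B e)" "f \<noteq> e" for f
    using edge_order_total[OF e, of f] assms(2) that
    by (auto simp: edges_into_def below_def maximal_edge_def)
  then show "edges_into (end_pt B e) = insert e (below e)"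
    using below_subset[of e] e by (auto simp: edges_into_def)
qed (simp add: below_def)

text \<open>The least edge strictly above \<open>e\<close> satisfies the description in
  \<open>edge_succ\<close>. The third claim is the form used for counting: offsets are sums over
  \<open>below\<close>, and the successor adds exactly the term of \<open>e\<close>.\<close>

lemma edge_succ:
  assumes e: "e \<in> edges B (Suc n)" and "\<not> maximal_edge B e"
  shows "edge_succ B e \<in> edges B (Suc n)" "end_pt B (edge_succ B e) = end_pt B e"
    "below (edge_succ B e) = insert e (below e)" "e \<notin> below e"
proof -
  define U where "U = {f. (e, f) \<in> edge_order B \<and> f \<noteq> e}"
  have all: "e \<in> all_edges B"
    using e all_edges_iff by blast
  have U: "f \<in> edges_into (end_pt B e)" if "f \<in> U" for f
    using that edge_order_all_edges[of e f] edge_order_end_pt[of e f]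
    by (auto simp: U_def edges_into_def)
  then have "finite U"
    by (intro finite_subset[OF _ finite_edges_into[OF end_pt_in[OF e]]]) blast
  moreover have "U \<noteq> {}"
    using assms(2) by (auto simp: U_def maximal_edge_def)
  moreover have "(f, g) \<in> edge_order B \<or> (g, f) \<in> edge_order B" if "f \<in> U" "g \<in> U" for f g
    using U[OF that(1)] U[OF that(2)] by (intro edge_order_total) (auto simp: edges_into_def)
  ultimately obtain f where f: "f \<in> U" "\<forall>g\<in>U. (f, g) \<in> edge_order B"
    using finite_total_least[of U "edge_order B"] edge_order_trans by blast
  have succ: "edge_succ B e = f"
    unfolding edge_succ_def
  proof (rule the_equality)
    show "(e, f) \<in> edge_order B \<and> f \<noteq> e \<and>
        (\<forall>g. (e, g) \<in> edge_order B \<and> g \<noteq> e \<longrightarrow> (f, g) \<in> edge_order B)"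
      using f by (auto simp: U_def)
    fix f'
    assume "(e, f') \<in> edge_order B \<and> f' \<noteq> e \<and>
        (\<forall>g. (e, g) \<in> edge_order B \<and> g \<noteq> e \<longrightarrow> (f', g) \<in> edge_order B)"
    with f show "f' = f"
      using edge_order_antisym by (auto simp: U_def)
  qed
  show "end_pt B (edge_succ B e) = end_pt B e"
    using U[OF f(1)] by (simp add: succ edges_into_def)
  then show "edge_succ B e \<in> edges B (Suc n)"
    using same_end_pt_level[OF _ e, of f] U[OF f(1)] by (simp add: succ edges_into_def)
  have ef: "(e, f) \<in> edge_order B" "f \<noteq> e"
    using f(1) by (auto simp: U_def)
  have "below f = insert e (below e)"
  proof (intro equalityI subsetI)
    fix g assume g: "g \<in> below f"
    then have "(e, g) \<in> edge_order B \<or> (g, e) \<in> edge_order B"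
      using edge_order_all_edges[of g f] edge_order_end_pt[of g f] edge_order_end_pt[OF ef(1)]
        edge_order_total[OF all, of g] by (auto simp: below_def)
    moreover have "g \<notin> U"
      using f(2) g edge_order_antisym by (auto simp: below_def)
    ultimately show "g \<in> insert e (below e)"
      by (auto simp: U_def below_def)
  next
    fix g assume "g \<in> insert e (below e)"
    then show "g \<in> below f"
      using below_trans[of e f] ef by (auto simp: below_def)
  qed
  then show "below (edge_succ B e) = insert e (below e)"
    by (simp add: succ)
qed (simp add: below_def)

text \<open>The greatest element of \<open>below e\<close> is its immediate predecessor; splitting
  it off allows rounding one edge at a time.\<close>

lemma below_predecessor:
  assumes e: "e \<in> edges B (Suc n)" and "below e \<noteq> {}"
  obtains f where "f \<in> below e" "below e = insert f (below f)" "f \<notin> below f"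
proof -
  have "f \<in> all_edges B" "end_pt B f = end_pt B e" if "f \<in> below e" for f
    using below_subset that by (auto simp: edges_into_def)
  then have "(f, g) \<in> (edge_order B)\<inverse> \<or> (g, f) \<in> (edge_order B)\<inverse>"
    if "f \<in> below e" "g \<in> below e" for f g
    using edge_order_total[of f g] that by auto
  then obtain f where f: "f \<in> below e" "\<forall>g\<in>below e. (g, f) \<in> edge_order B"
    using finite_total_least[of "below e" "(edge_order B)\<inverse>"] finite_below[OF e] assms(2)
      edge_order_trans by auto
  have "below e = insert f (below f)"
  proof (intro equalityI subsetI)
    fix g assume "g \<in> below e"
    with f show "g \<in> insert f (below f)"
      by (auto simp: below_def)
  next
    fix g assume "g \<in> insert f (below f)"
    with f(1) show "g \<in> below e"
      using below_trans by blast
  qed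
  with f(1) that show ?thesis
    by (simp add: below_def)
qed

lemma edge_induct [consumes 1, case_names step]:
  assumes "e \<in> edges B (Suc n)"
    and step: "\<And>e. e \<in> edges B (Suc n) \<Longrightarrow> (\<And>f. f \<in> below e \<Longrightarrow> P f) \<Longrightarrow> P e"
  shows "P e"
  using assms(1)
proof (induction "card (below e)" arbitrary: e rule: less_induct)
  case less
  have "P f" if f: "f \<in> below e" for f
  proof (rule less.hyps)
    show "f \<in> edges B (Suc n)"
      using below_level[OF less.prems f] .
    have "below f \<subseteq> below e"
      using below_trans[OF f] by blast
    moreover have "f \<in> below e - below f"
      using f by (simp add: below_def)
    ultimately show "card (below f) < card (below e)"
      using finite_below[OF less.prems] by (intro psubset_card_mono) auto
  qed
  then show ?case
    using step less.prems by blast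
qed

lemma ex1_minimal_edge:
  assumes "v \<in> vertices B (Suc n)"
  shows "\<exists>!e. e \<in> edges B (Suc n) \<and> end_pt B e = v \<and> minimal_edge B e"
proof -
  have "(e, f) \<in> edge_order B \<or> (f, e) \<in> edge_order B"
    if "e \<in> edges_into v" "f \<in> edges_into v" for e f
    using that by (intro edge_order_total) (auto simp: edges_into_def)
  moreover have "edges_into v \<noteq> {}"
    using ex_edge_into[OF assms] edges_into_level[OF assms] by blast
  ultimately obtain e where e: "e \<in> edges_into v" "\<forall>f\<in>edges_into v. (e, f) \<in> edge_order B"
    using finite_total_least[OF finite_edges_into[OF assms]] edge_order_trans by blast
  have "minimal_edge B e"
    unfolding minimal_edge_def
  proof (intro allI impI)
    fix f assume f: "(f, e) \<in> edge_order B"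
    then have "f \<in> edges_into v"
      using e(1) edge_order_all_edges edge_order_end_pt by (auto simp: edges_into_def)
    with e(2) f show "f = e"
      using edge_order_antisym by blast
  qed
  moreover have "f = e" if "f \<in> edges_into v" "minimal_edge B f" for f
    using e that by (auto simp: minimal_edge_def)
  ultimately show ?thesis
    using e(1) unfolding edges_into_level[OF assms] by blast
qed

lemma ex_maximal_edge:
  assumes "v \<in> vertices B (Suc n)"
  shows "\<exists>e\<in>edges B (Suc n). end_pt B e = v \<and> maximal_edge B e"
proof -
  have "(e, f) \<in> (edge_order B)\<inverse> \<or> (f, e) \<in> (edge_order B)\<inverse>"
    if "e \<in> edges_into v" "f \<in> edges_into v" for e f
    using that edge_order_total[of e f] by (auto simp: edges_into_def)
  moreover have "edges_into v \<noteq> {}"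
    using ex_edge_into[OF assms] edges_into_level[OF assms] by blast
  ultimately obtain e where e: "e \<in> edges_into v" "\<forall>f\<in>edges_into v. (f, e) \<in> edge_order B"
    using finite_total_least[OF finite_edges_into[OF assms], of "(edge_order B)\<inverse>"] edge_order_trans
    by auto
  have "maximal_edge B e"
    unfolding maximal_edge_def
  proof (intro allI impI)
    fix f assume f: "(e, f) \<in> edge_order B"
    then have "f \<in> edges_into v"
      using e(1) edge_order_all_edges edge_order_end_pt by (auto simp: edges_into_def)
    with e(2) f show "f = e"
      using edge_order_antisym by blast
  qed
  then show ?thesis
    using e(1) unfolding edges_into_level[OF assms] by blast
qed

section \<open>Paths with a minimal beginning, and the Vershik map\<close>

lemma pathsD:
  assumes "x \<in> paths B"
  shows "x n \<in> edges B (Suc n)" "init_pt B (x (Suc n)) = end_pt B (x n)"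
    "init_pt B (x n) \<in> vertices B n"
  using assms init_pt_in by (auto simp: paths_def)

text \<open>The prefix is built downwards from level \<open>n\<close>: the initial point of an edge
  already chosen has exactly one minimal edge into it. Together with
  \<open>minimal_prefix_unique\<close> this justifies the definite description in
  \<open>vershik_map\<close>.\<close>

lemma ex_minimal_prefix:
  assumes "\<And>k. k \<ge> n \<Longrightarrow> z k \<in> edges B (Suc k) \<and> init_pt B (z (Suc k)) = end_pt B (z k)"
  shows "\<exists>y\<in>paths B. (\<forall>i<n. minimal_edge B (y i)) \<and> (\<forall>i\<ge>n. y i = z i)"
  using assms
proof (induction n arbitrary: z)
  case 0
  then show ?case
    by (intro bexI[of _ z]) (auto simp: paths_def)
next
  case (Suc n)
  have "init_pt B (z (Suc n)) \<in> vertices B (Suc n)"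
    using Suc.prems[of "Suc n"] by (intro init_pt_in) auto
  then obtain e where e: "e \<in> edges B (Suc n)" "end_pt B e = init_pt B (z (Suc n))" "minimal_edge B e"
    using ex1_minimal_edge by metis
  have "(z(n := e)) k \<in> edges B (Suc k) \<and> init_pt B ((z(n := e)) (Suc k)) = end_pt B ((z(n := e)) k)"
    if "k \<ge> n" for k
    using Suc.prems[of k] e that by (cases "k = n") auto
  from Suc.IH[OF this] obtain y where y: "y \<in> paths B" "\<forall>i<n. minimal_edge B (y i)"
    "\<forall>i\<ge>n. y i = (z(n := e)) i"
    by blast
  then have "minimal_edge B (y i)" if "i < Suc n" for i
    using e(3) that by (cases "i = n") auto
  with y show ?case
    by (intro bexI[of _ y]) auto
qed

lemma minimal_prefix_unique:
  assumes "y \<in> paths B" "y' \<in> paths B" "\<And>i. i < n \<Longrightarrow> minimal_edge B (y i) \<and> minimal_edge B (y' i)"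
    and "\<And>i. i \<ge> n \<Longrightarrow> y i = y' i"
  shows "y = y'"
  using assms(3,4)
proof (induction n)
  case 0
  then show ?case
    by auto
next
  case (Suc n)
  have "end_pt B (y n) = end_pt B (y' n)"
    using Suc.prems(2)[of "Suc n"] pathsD(2)[OF assms(1), of n] pathsD(2)[OF assms(2), of n] by simp
  then have "y n = y' n"
    using ex1_minimal_edge[OF end_pt_in[OF pathsD(1)[OF assms(1)]], of n] Suc.prems(1)[of n]
      pathsD(1)[OF assms(1), of n] pathsD(1)[OF assms(2), of n] by auto
  show ?case
  proof (rule Suc.IH)
    show "minimal_edge B (y i) \<and> minimal_edge B (y' i)" if "i < n" for i
      using Suc.prems(1) that by simp
    show "y i = y' i" if "i \<ge> n" for i
      using Suc.prems(2)[of i] \<open>y n = y' n\<close> that by (cases "i = n") auto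
  qed
qed

lemma ex_path_through_edge:
  assumes "e \<in> edges B (Suc n)"
  shows "\<exists>y\<in>paths B. (\<forall>i<n. minimal_edge B (y i)) \<and> y n = e"
proof -
  have "\<exists>g. \<forall>k. (g k \<in> edges B (Suc (n + k)) \<and> (k = 0 \<longrightarrow> g k = e)) \<and> init_pt B (g (Suc k)) = end_pt B (g k)"
  proof (rule dependent_nat_choice)
    show "\<exists>x. x \<in> edges B (Suc (n + 0)) \<and> (0 = (0::nat) \<longrightarrow> x = e)"
      using assms by simp
    show "\<exists>y. (y \<in> edges B (Suc (n + Suc k)) \<and> (Suc k = 0 \<longrightarrow> y = e)) \<and> init_pt B y = end_pt B x"
      if "x \<in> edges B (Suc (n + k)) \<and> (k = 0 \<longrightarrow> x = e)" for x k
      using that ex_edge_from[OF end_pt_in[of x "n + k"]] by auto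
  qed
  then obtain g where g: "\<And>k. g k \<in> edges B (Suc (n + k))" "g 0 = e"
    "\<And>k. init_pt B (g (Suc k)) = end_pt B (g k)"
    by blast
  define z where "z k = g (k - n)" for k
  have "z k \<in> edges B (Suc k) \<and> init_pt B (z (Suc k)) = end_pt B (z k)" if "k \<ge> n" for k
    using g(1)[of "k - n"] g(3)[of "k - n"] that by (simp add: z_def Suc_diff_le)
  from ex_minimal_prefix[OF this] obtain y where "y \<in> paths B" "\<forall>i<n. minimal_edge B (y i)"
    "\<forall>i\<ge>n. y i = z i"
    by blast
  then show ?thesis
    using g(2) by (intro bexI[of _ y]) (auto simp: z_def)
qed

lemma vershik_max_path:
  assumes "max_path B x"
  shows "min_path B (vershik_map B x)"
proof -
  have "\<exists>!y. min_path B y"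
    using proper by (simp add: properly_ordered_def)
  from theI'[OF this] show ?thesis
    using assms by (simp add: vershik_map_def)
qed

lemma vershik_step:
  assumes x: "x \<in> paths B" and max: "\<And>i. i < k \<Longrightarrow> maximal_edge B (x i)" and k: "\<not> maximal_edge B (x k)"
  shows "vershik_map B x \<in> paths B" "\<And>i. i < k \<Longrightarrow> minimal_edge B (vershik_map B x i)"
    "vershik_map B x k = edge_succ B (x k)" "\<And>i. i > k \<Longrightarrow> vershik_map B x i = x i"
proof -
  let ?P = "\<lambda>y. y \<in> paths B \<and> (\<forall>n<k. minimal_edge B (y n)) \<and> y k = edge_succ B (x k) \<and>
    (\<forall>n>k. y n = x n)"
  have least: "(LEAST k. \<not> maximal_edge B (x k)) = k"
  proof (rule Least_equality)
    show "\<not> maximal_edge B (x k)"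
      by (rule k)
    show "k \<le> i" if "\<not> maximal_edge B (x i)" for i
      using max[of i] that by (cases "i < k") auto
  qed
  have "\<not> max_path B x"
    using k by (auto simp: max_path_def)
  then have eq: "vershik_map B x = (THE y. ?P y)"
    by (simp add: vershik_map_def least)
  have "\<exists>!y. ?P y"
  proof -
    define z where "z = x(k := edge_succ B (x k))"
    have "z i \<in> edges B (Suc i) \<and> init_pt B (z (Suc i)) = end_pt B (z i)" if "i \<ge> k" for i
      using pathsD(1)[OF x, of i] pathsD(2)[OF x, of i] edge_succ[OF pathsD(1)[OF x] k] that
      by (cases "i = k") (auto simp: z_def)
    from ex_minimal_prefix[OF this] obtain y where y: "y \<in> paths B" "\<forall>i<k. minimal_edge B (y i)"
      "\<forall>i\<ge>k. y i = z i"
      by blast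
    then have "?P y"
      by (auto simp: z_def)
    moreover have "y' = y" if "?P y'" for y'
    proof (rule minimal_prefix_unique)
      show "y' i = y i" if "i \<ge> k" for i
        using that \<open>?P y\<close> \<open>?P y'\<close> by (cases "i = k") auto
    qed (use \<open>?P y\<close> \<open>?P y'\<close> in auto)
    ultimately show ?thesis
      by (rule ex1I)
  qed
  from theI'[OF this] show "vershik_map B x \<in> paths B" "\<And>i. i < k \<Longrightarrow> minimal_edge B (vershik_map B x i)"
    "vershik_map B x k = edge_succ B (x k)" "\<And>i. i > k \<Longrightarrow> vershik_map B x i = x i"
    unfolding eq by blast+
qed

lemma first_nonmaximal:
  fixes j :: nat
  assumes "\<not> maximal_edge B (x j)"
  obtains k where "k \<le> j" "\<And>i. i < k \<Longrightarrow> maximal_edge B (x i)" "\<not> maximal_edge B (x k)"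
proof (rule that)
  let ?k = "LEAST k. \<not> maximal_edge B (x k)"
  show "?k \<le> j"
    using Least_le[of "\<lambda>k. \<not> maximal_edge B (x k)" j] assms by simp
  show "\<not> maximal_edge B (x ?k)"
    using LeastI[of "\<lambda>k. \<not> maximal_edge B (x k)" j] assms by simp
  show "maximal_edge B (x i)" if "i < ?k" for i
    using not_less_Least[OF that] by simp
qed

lemma vershik_in_paths:
  assumes "x \<in> paths B"
  shows "vershik_map B x \<in> paths B"
proof (cases "max_path B x")
  case True
  then show ?thesis
    using vershik_max_path by (simp add: min_path_def)
next
  case False
  then obtain j where "\<not> maximal_edge B (x j)"
    using assms by (auto simp: max_path_def)
  then obtain k where "\<And>i. i < k \<Longrightarrow> maximal_edge B (x i)" "\<not> maximal_edge B (x k)"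
    using first_nonmaximal[of x j] by blast
  then show ?thesis
    using vershik_step(1)[OF assms] by blast
qed

section \<open>Heights (numbers of finite paths from the root), offsets and floors\<close>

primrec height :: "nat \<Rightarrow> nat \<times> nat \<Rightarrow> nat" where
  "height 0 v = 1"
| "height (Suc n) v = (\<Sum>e\<in>edges_into v. height n (init_pt B e))"

text \<open>Inside the tower over \<open>end_pt B e\<close>, towers of level \<open>n\<close> are
  stacked in the order of the edges; this is the floor at which the copy belonging to
  \<open>e\<close> begins.\<close>

definition edge_offset :: "nat \<Rightarrow> 'e \<Rightarrow> nat" where
  "edge_offset n e = (\<Sum>f\<in>below e. height n (init_pt B f))"

text \<open>The number of steps from the path that is minimal up to level \<open>n\<close> to \<open>x\<close>.\<close>

definition floor_of :: "nat \<Rightarrow> (nat \<Rightarrow> 'e) \<Rightarrow> nat" where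
  "floor_of n x = (\<Sum>k<n. edge_offset k (x k))"

lemma floor_of_Suc [simp]: "floor_of (Suc n) x = floor_of n x + edge_offset n (x n)"
  and floor_of_0 [simp]: "floor_of 0 x = 0"
  by (simp_all add: floor_of_def)

lemma height_pos: "v \<in> vertices B n \<Longrightarrow> height n v > 0"
proof (induction n arbitrary: v)
  case (Suc n)
  obtain e where e: "e \<in> edges B (Suc n)" "end_pt B e = v"
    using ex_edge_into[OF Suc.prems] by blast
  then have "e \<in> edges_into v"
    using edges_into_level[OF Suc.prems] by simp
  then show ?case
    using Suc.IH[OF init_pt_in[OF e(1)]] finite_edges_into[OF Suc.prems]
    by (auto simp: sum_pos2)
qed simp

lemma edge_offset_eq_0_iff:
  assumes "e \<in> edges B (Suc n)"
  shows "edge_offset n e = 0 \<longleftrightarrow> minimal_edge B e"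
proof -
  have "height n (init_pt B f) \<noteq> 0" if "f \<in> below e" for f
    using height_pos[OF init_pt_in[OF below_level[OF assms that]]] by simp
  then show ?thesis
    using finite_below[OF assms] by (auto simp: edge_offset_def below_minimal_edge)
qed

lemma floor_of_eq_0_iff: "x \<in> paths B \<Longrightarrow> floor_of n x = 0 \<longleftrightarrow> (\<forall>i<n. minimal_edge B (x i))"
  using edge_offset_eq_0_iff pathsD(1) by (auto simp: floor_of_def)

lemma height_Suc_maximal_edge:
  assumes "e \<in> edges B (Suc n)" "maximal_edge B e"
  shows "height (Suc n) (end_pt B e) = height n (init_pt B e) + edge_offset n e"
  using edges_into_maximal_edge[OF assms] finite_below[OF assms(1)] by (simp add: edge_offset_def)

lemma edge_offset_succ:
  assumes "e \<in> edges B (Suc n)" "\<not> maximal_edge B e"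
  shows "edge_offset n (edge_succ B e) = height n (init_pt B e) + edge_offset n e"
  using edge_succ[OF assms] finite_below[OF assms(1)] by (simp add: edge_offset_def)

text \<open>Maximal edges always select the topmost copy, which leads to the top floor. Its number
  is the height minus 1, as floors are counted from 0.\<close>

lemma floor_of_maximal:
  "x \<in> paths B \<Longrightarrow> \<forall>i<n. maximal_edge B (x i) \<Longrightarrow> Suc (floor_of n x) = height n (init_pt B (x n))"
proof (induction n)
  case (Suc n)
  then show ?case
    using height_Suc_maximal_edge[OF pathsD(1), of x n] pathsD(2)[of x n] by simp
qed simp

text \<open>Carrying, as in an odometer: if \<open>k\<close> is the first non-maximal position,
  resetting the edges before \<open>k\<close> loses the height of level \<open>k\<close> minus 1,
  and the successor at \<open>k\<close> gains that whole height. The net change is 1, and nothing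
  beyond \<open>k\<close> moves.\<close>

lemma floor_of_vershik:
  assumes x: "x \<in> paths B" and "\<exists>i<n. \<not> maximal_edge B (x i)"
  shows "floor_of n (vershik_map B x) = Suc (floor_of n x)"
    "init_pt B (vershik_map B x n) = init_pt B (x n)"
proof -
  obtain k where k: "k < n" "\<And>i. i < k \<Longrightarrow> maximal_edge B (x i)" "\<not> maximal_edge B (x k)"
  proof -
    obtain j where "j < n" "\<not> maximal_edge B (x j)"
      using assms(2) by blast
    then obtain k where "k \<le> j" "\<And>i. i < k \<Longrightarrow> maximal_edge B (x i)" "\<not> maximal_edge B (x k)"
      using first_nonmaximal[of x j] by blast
    with \<open>j < n\<close> that[of k] show ?thesis
      by simp
  qed
  note step = vershik_step[OF x k(2,3)]
  show "init_pt B (vershik_map B x n) = init_pt B (x n)"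
    using step(4) k(1) by simp
  have "Suc k \<le> n"
    using k(1) by simp
  then show "floor_of n (vershik_map B x) = Suc (floor_of n x)"
  proof (induction n rule: dec_induct)
    case base
    have "floor_of k (vershik_map B x) = 0"
      using floor_of_eq_0_iff[OF step(1)] step(2) by blast
    then show ?case
      using step(3) edge_offset_succ[OF pathsD(1)[OF x] k(3)] floor_of_maximal[OF x, of k] k(2) by simp
  next
    case (step n)
    then show ?case
      using vershik_step(4)[OF x k(2,3), of n] by simp
  qed
qed

lemma floor_of_vershik_maximal:
  assumes x: "x \<in> paths B" and max: "\<forall>i<n. maximal_edge B (x i)"
  shows "floor_of n (vershik_map B x) = 0"
proof (cases "max_path B x")
  case True
  then show ?thesis
    using vershik_max_path floor_of_eq_0_iff vershik_in_paths[OF x] by (simp add: min_path_def)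
next
  case False
  then obtain k where k: "\<And>i. i < k \<Longrightarrow> maximal_edge B (x i)" "\<not> maximal_edge B (x k)"
  proof -
    obtain j where "\<not> maximal_edge B (x j)"
      using False x by (auto simp: max_path_def)
    with that show ?thesis
      using first_nonmaximal[of x j] by blast
  qed
  then have "n \<le> k"
    using max linorder_not_less by blast
  then show ?thesis
    using vershik_step(2)[OF x k] floor_of_eq_0_iff vershik_in_paths[OF x] by simp
qed

lemma edge_offset_add_height_le:
  assumes "f \<in> edges B (Suc n)" "e \<in> below f"
  shows "edge_offset n e + height n (init_pt B e) \<le> edge_offset n f"
proof -
  have "insert e (below e) \<subseteq> below f"
    using below_trans[OF assms(2)] .
  then have "(\<Sum>g\<in>insert e (below e). height n (init_pt B g)) \<le> edge_offset n f"
    unfolding edge_offset_def using finite_below[OF assms(1)] by (intro sum_mono2) auto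
  moreover have "e \<notin> below e" "finite (below e)"
    using finite_below[OF below_level[OF assms]] by (auto simp: below_def)
  ultimately show ?thesis
    by (simp add: edge_offset_def)
qed

lemma edge_offset_add_height_le_height:
  assumes "e \<in> edges B (Suc n)"
  shows "edge_offset n e + height n (init_pt B e) \<le> height (Suc n) (end_pt B e)"
proof -
  have "insert e (below e) \<subseteq> edges_into (end_pt B e)"
    using below_subset[of e] edges_into_level[OF end_pt_in[OF assms]] assms by auto
  then have "(\<Sum>g\<in>insert e (below e). height n (init_pt B g)) \<le> height (Suc n) (end_pt B e)"
    using finite_edges_into[OF end_pt_in[OF assms]] by (auto intro!: sum_mono2)
  moreover have "e \<notin> below e"
    by (simp add: below_def)
  ultimately show ?thesis
    using finite_below[OF assms] by (simp add: edge_offset_def)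
qed

lemma floor_of_less: "x \<in> paths B \<Longrightarrow> floor_of n x < height n (init_pt B (x n))"
proof (induction n)
  case (Suc n)
  then show ?case
    using edge_offset_add_height_le_height[OF pathsD(1), of x n] pathsD(2)[of x n] by simp
qed simp

text \<open>For the edges into one vertex, the intervals that begin at
  \<open>edge_offset n e\<close> and have length \<open>height n (init_pt B e)\<close> are stacked
  without overlap.\<close>

lemma floor_decomposition_unique:
  assumes ef: "e \<in> edges B (Suc n)" "f \<in> edges B (Suc n)" "end_pt B e = end_pt B f"
    and less: "r < height n (init_pt B e)" "s < height n (init_pt B f)"
    and eq: "r + edge_offset n e = s + edge_offset n f"
  shows "e = f"
proof (rule ccontr)
  assume "e \<noteq> f"
  have "e \<in> all_edges B" "f \<in> all_edges B"
    using ef all_edges_iff by blast+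
  then have "e \<in> below f \<or> f \<in> below e"
    using edge_order_total[of e f] ef(3) \<open>e \<noteq> f\<close> by (auto simp: below_def)
  then show False
    using edge_offset_add_height_le[OF ef(2), of e] edge_offset_add_height_le[OF ef(1), of f] less eq
    by linarith
qed

text \<open>A floor number is a mixed radix expansion with edges as digits: vertex and floor
  determine the last edge and a remainder, to which the induction applies.\<close>

lemma floor_of_unique:
  assumes x: "x \<in> paths B" and y: "y \<in> paths B"
  shows "init_pt B (x n) = init_pt B (y n) \<Longrightarrow> floor_of n x = floor_of n y \<Longrightarrow> \<forall>i<n. x i = y i"
proof (induction n)
  case (Suc n)
  have "x n = y n"
    using Suc.prems pathsD[OF x] pathsD[OF y] floor_of_less[OF x] floor_of_less[OF y]
    by (intro floor_decomposition_unique[of _ n _ "floor_of n x" "floor_of n y"]) auto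
  with Suc show ?case
    by (simp add: less_Suc_eq)
qed simp

section \<open>Cylinder sets as neighbourhoods in the path space\<close>

lemma topspace_path_space: "topspace (path_space B) = paths B"
  by (auto simp: path_space_def topology_generated_by_topspace cylinder_def)

lemma openin_cylinder: "x \<in> paths B \<Longrightarrow> openin (path_space B) (cylinder B x n)"
  unfolding path_space_def by (rule topology_generated_by_Basis) blast

lemma openin_path_space_cylinder:
  assumes "openin (path_space B) U" "x \<in> U"
  shows "\<exists>n. cylinder B x n \<subseteq> U"
proof -
  have "generate_topology_on {cylinder B x n | x n. x \<in> paths B} U"
    using assms(1) by (simp add: path_space_def openin_topology_generated_by_iff)
  then show ?thesis
    using assms(2)
  proof (induction arbitrary: x)
    case (Int a b)
    then obtain m n where "cylinder B x m \<subseteq> a" "cylinder B x n \<subseteq> b"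
      by blast
    moreover have "cylinder B x (max m n) \<subseteq> cylinder B x m \<inter> cylinder B x n"
      by (auto simp: cylinder_def)
    ultimately show ?case
      by blast
  next
    case (UN K)
    then show ?case
      by blast
  next
    case (Basis s)
    then obtain y n where s: "s = cylinder B y n"
      by blast
    with Basis have "cylinder B x n \<subseteq> s"
      by (auto simp: cylinder_def)
    then show ?case
      by blast
  qed simp
qed

end

section \<open>Towers, invariant measures and eigenvalues\<close>

text \<open>The system stays on \<open>X\<close> and only the coordinates are read through the
  conjugacy \<open>h\<close>, so eigenfunctions and invariant measures never have to be transferred
  to the path space.\<close>

locale bratteli_vershik_system = properly_ordered_diagram B
  for B :: "('e, 'z) bratteli_diagram_scheme" +
  fixes X :: "'a topology" and T :: "'a \<Rightarrow> 'a" and h :: "'a \<Rightarrow> nat \<Rightarrow> 'e"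
  assumes compact: "compact_space X"
    and T: "homeomorphic_map X X T"
    and h: "homeomorphic_map X (path_space B) h"
    and h_T: "\<And>x. x \<in> topspace X \<Longrightarrow> h (T x) = vershik_map B (h x)"
begin

lemma h_in_paths: "x \<in> topspace X \<Longrightarrow> h x \<in> paths B"
  using homeomorphic_imp_surjective_map[OF h] by (auto simp: topspace_path_space)

lemma h_surj: "p \<in> paths B \<Longrightarrow> \<exists>x\<in>topspace X. h x = p"
  using homeomorphic_imp_surjective_map[OF h] by (metis imageE topspace_path_space)

lemma h_inj: "x \<in> topspace X \<Longrightarrow> y \<in> topspace X \<Longrightarrow> h x = h y \<Longrightarrow> x = y"
  using homeomorphic_imp_injective_map[OF h] by (auto simp: inj_on_def)

lemma ex_base_point: "\<exists>x\<in>topspace X. min_path B (h x)"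
proof -
  obtain p where "min_path B p"
    using proper by (auto simp: properly_ordered_def)
  then show ?thesis
    using h_surj[of p] by (auto simp: min_path_def)
qed

lemma T_in: "x \<in> topspace X \<Longrightarrow> T x \<in> topspace X"
  using homeomorphic_imp_surjective_map[OF T] by auto

lemma funpow_T_in: "x \<in> topspace X \<Longrightarrow> (T ^^ j) x \<in> topspace X"
  by (induction j) (auto intro: T_in)

text \<open>The edge at position \<open>n\<close> leaves level \<open>n\<close>, so its initial
  point is the vertex of level \<open>n\<close> on the path; this reading also covers the
  root.\<close>

definition tower :: "nat \<Rightarrow> nat \<times> nat \<Rightarrow> nat \<Rightarrow> 'a set" where
  "tower n v i = {x \<in> topspace X. init_pt B (h x n) = v \<and> floor_of n (h x) = i}"

lemma tower_level:
  assumes "x \<in> tower n v i"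
  shows "v \<in> vertices B n" "i < height n v"
  using assms h_in_paths pathsD(3) floor_of_less by (auto simp: tower_def)

lemma openin_tower: "openin X (tower n v i)"
proof -
  define W where "W = {p \<in> paths B. init_pt B (p n) = v \<and> floor_of n p = i}"
  have "cylinder B p (Suc n) \<subseteq> W" if "p \<in> W" for p
  proof
    fix q assume q: "q \<in> cylinder B p (Suc n)"
    then have "floor_of n q = floor_of n p" "q n = p n"
      by (auto simp: cylinder_def floor_of_def)
    with q that show "q \<in> W"
      by (auto simp: W_def cylinder_def)
  qed
  moreover have "p \<in> cylinder B p (Suc n)" if "p \<in> W" for p
    using that by (auto simp: W_def cylinder_def)
  ultimately have "W = (\<Union>p\<in>W. cylinder B p (Suc n))"
    by blast
  moreover have "openin (path_space B) (\<Union>p\<in>W. cylinder B p (Suc n))"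
    by (intro openin_Union) (auto simp: W_def intro: openin_cylinder)
  ultimately have "openin (path_space B) W"
    by simp
  then have "openin X {x \<in> topspace X. h x \<in> W}"
    using homeomorphic_imp_continuous_map[OF h] by (simp add: continuous_map_def)
  moreover have "{x \<in> topspace X. h x \<in> W} = tower n v i"
    using h_in_paths by (auto simp: W_def tower_def)
  ultimately show ?thesis
    by simp
qed

lemma tower_vimage:
  assumes "Suc i < height n v"
  shows "T -` tower n v (Suc i) \<inter> topspace X = tower n v i"
proof (intro equalityI subsetI)
  fix x assume "x \<in> T -` tower n v (Suc i) \<inter> topspace X"
  then have x: "x \<in> topspace X" "init_pt B (vershik_map B (h x) n) = v"
    "floor_of n (vershik_map B (h x)) = Suc i"
    by (auto simp: tower_def h_T)
  have "\<exists>k<n. \<not> maximal_edge B (h x k)"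
    using floor_of_vershik_maximal[OF h_in_paths[OF x(1)], of n] x(3) by auto
  from floor_of_vershik[OF h_in_paths[OF x(1)] this] show "x \<in> tower n v i"
    using x by (simp add: tower_def)
next
  fix x assume "x \<in> tower n v i"
  then have x: "x \<in> topspace X" "init_pt B (h x n) = v" "floor_of n (h x) = i"
    by (auto simp: tower_def)
  have "\<exists>k<n. \<not> maximal_edge B (h x k)"
    using floor_of_maximal[OF h_in_paths[OF x(1)], of n] x assms by auto
  from floor_of_vershik[OF h_in_paths[OF x(1)] this] show "x \<in> T -` tower n v (Suc i) \<inter> topspace X"
    using x by (simp add: tower_def h_T T_in)
qed

lemma tower_climb: "x \<in> tower n v 0 \<Longrightarrow> i < height n v \<Longrightarrow> (T ^^ i) x \<in> tower n v i"
proof (induction i)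
  case (Suc i)
  then show ?case
    using tower_vimage[of i n v] by auto
qed simp

text \<open>On the top floor the first \<open>n\<close> edges are all maximal, since otherwise the
  next floor number in the same tower would equal the height. Hence the next step enters some
  base.\<close>

lemma tower_return:
  assumes x: "x \<in> tower n v 0"
  shows "floor_of n (h ((T ^^ height n v) x)) = 0"
proof -
  obtain i where i: "height n v = Suc i"
    using tower_level[OF x] by (cases "height n v") auto
  define y where "y = (T ^^ i) x"
  have "y \<in> tower n v i"
    unfolding y_def using tower_climb[OF x] i by simp
  then have y: "y \<in> topspace X" "init_pt B (h y n) = v" "floor_of n (h y) = i"
    by (auto simp: tower_def)
  have "\<forall>k<n. maximal_edge B (h y k)"
  proof (rule ccontr)
    assume "\<not> ?thesis"
    then have "\<exists>k<n. \<not> maximal_edge B (h y k)"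
      by blast
    from floor_of_vershik[OF h_in_paths[OF y(1)] this] show False
      using floor_of_less[OF vershik_in_paths[OF h_in_paths[OF y(1)]], of n] y i by simp
  qed
  from floor_of_vershik_maximal[OF h_in_paths[OF y(1)] this] show ?thesis
    using y(1) by (simp add: i y_def h_T)
qed

lemma ex_tower_base:
  assumes "v \<in> vertices B n"
  shows "\<exists>x. x \<in> tower n v 0"
proof -
  obtain e where e: "e \<in> edges B (Suc n)" "init_pt B e = v"
    using ex_edge_from[OF assms] by blast
  then obtain p where p: "p \<in> paths B" "\<forall>i<n. minimal_edge B (p i)" "p n = e"
    using ex_path_through_edge by blast
  then obtain x where "x \<in> topspace X" "h x = p"
    using h_surj by blast
  then show ?thesis
    using p e(2) floor_of_eq_0_iff by (auto simp: tower_def)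
qed

text \<open>Cutting and stacking: the next edge cuts a base of level \<open>n\<close> into floors of
  level \<open>n + 1\<close>. This relates the base measures of the two levels and makes
  \<open>edge_offset n e\<close> a travel time between bases of level \<open>n\<close>.\<close>

lemma tower_refine:
  assumes e: "e \<in> edges B (Suc n)"
  shows "tower (Suc n) (end_pt B e) (edge_offset n e) = {x \<in> tower n (init_pt B e) 0. h x n = e}"
proof (intro equalityI subsetI)
  fix x assume "x \<in> tower (Suc n) (end_pt B e) (edge_offset n e)"
  then have x: "x \<in> topspace X" "init_pt B (h x (Suc n)) = end_pt B e"
    "floor_of n (h x) + edge_offset n (h x n) = edge_offset n e"
    by (auto simp: tower_def)
  note p = pathsD[OF h_in_paths[OF x(1)]]
  have "h x n = e"
  proof (rule floor_decomposition_unique[of _ n _ "floor_of n (h x)" 0])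
    show "0 < height n (init_pt B e)"
      using height_pos init_pt_in e by blast
  qed (use x p e floor_of_less[OF h_in_paths[OF x(1)]] in auto)
  with x show "x \<in> {x \<in> tower n (init_pt B e) 0. h x n = e}"
    by (simp add: tower_def)
next
  fix x assume "x \<in> {x \<in> tower n (init_pt B e) 0. h x n = e}"
  then show "x \<in> tower (Suc n) (end_pt B e) (edge_offset n e)"
    using pathsD(2)[OF h_in_paths, of x n] by (auto simp: tower_def)
qed

lemma tower_in_tower:
  assumes "x \<in> tower n w j" "y \<in> tower n w j" "x \<in> tower m v i" "m \<le> n"
  shows "y \<in> tower m v i"
proof -
  have eq: "\<forall>k<n. h x k = h y k"
    using assms(1,2) h_in_paths by (intro floor_of_unique) (auto simp: tower_def)
  then have "floor_of m (h x) = floor_of m (h y)"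
    using assms(4) by (simp add: floor_of_def)
  moreover have "init_pt B (h x m) = init_pt B (h y m)"
    using eq assms by (cases "m = n") (auto simp: tower_def)
  ultimately show ?thesis
    using assms(2,3) by (simp add: tower_def)
qed

text \<open>The empty set is added because floors of different levels are either nested or disjoint,
  which makes the family stable under intersection.\<close>

definition towers :: "'a set set" where
  "towers = insert {} (range (\<lambda>(n, v, i). tower n v i))"

lemma Int_stable_towers: "Int_stable towers"
proof (rule Int_stableI)
  have *: "tower m v i \<inter> tower n w j \<in> towers" if "m \<le> n" for m v i n w j
  proof (cases "tower m v i \<inter> tower n w j = {}")
    case True
    then show ?thesis
      by (simp add: towers_def)
  next
    case False
    then obtain x where "x \<in> tower m v i" "x \<in> tower n w j"
      by blast
    then have "tower m v i \<inter> tower n w j = tower n w j"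
      using tower_in_tower[of x n w j _ m v i] that by blast
    then show ?thesis
      by (auto simp: towers_def)
  qed
  fix a b assume "a \<in> towers" "b \<in> towers"
  then consider "a \<inter> b = {}" | m v i n w j where "a = tower m v i" "b = tower n w j"
    by (auto simp: towers_def)
  then show "a \<inter> b \<in> towers"
  proof cases
    case 1
    then show ?thesis
      by (simp add: towers_def)
  next
    case 2
    then show ?thesis
      using *[of m n v i w j] *[of n m w j v i] by (cases "m \<le> n") (simp_all add: Int_commute)
  qed
qed

lemma openin_Union_towers:
  assumes U: "openin X U"
  shows "U = \<Union>{A \<in> towers. A \<subseteq> U}"
proof (intro equalityI subsetI)
  fix x assume x: "x \<in> U"
  have UX: "U \<subseteq> topspace X"
    using U by (rule openin_subset)
  have "openin (path_space B) (h ` U)"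
    using homeomorphic_imp_open_map[OF h] U by (simp add: open_map_def)
  then obtain n where n: "cylinder B (h x) n \<subseteq> h ` U"
    using openin_path_space_cylinder x by blast
  define A where "A = tower n (init_pt B (h x n)) (floor_of n (h x))"
  have "x \<in> A"
    using x UX by (auto simp: A_def tower_def)
  moreover have "A \<subseteq> U"
  proof
    fix y assume y: "y \<in> A"
    then have "\<forall>k<n. h y k = h x k"
      using x UX h_in_paths by (intro floor_of_unique) (auto simp: A_def tower_def)
    then have "h y \<in> cylinder B (h x) n"
      using y h_in_paths by (auto simp: A_def tower_def cylinder_def)
    then obtain z where "z \<in> U" "h y = h z"
      using n by blast
    then show "y \<in> U"
      using h_inj[of y z] y UX by (auto simp: A_def tower_def)
  qed
  moreover have "A \<in> towers"
    by (auto simp: A_def towers_def)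
  ultimately show "x \<in> \<Union>{A \<in> towers. A \<subseteq> U}"
    by blast
qed blast

lemma towers_subset: "towers \<subseteq> Pow (topspace X)"
  by (auto simp: towers_def tower_def)

lemma sigma_sets_towers: "sigma_sets (topspace X) {U. openin X U} = sigma_sets (topspace X) towers"
proof (rule sigma_sets_eqI)
  fix U assume "U \<in> {U. openin X U}"
  then have "U = \<Union>{A \<in> towers. A \<subseteq> U}"
    using openin_Union_towers by blast
  moreover have "countable {A \<in> towers. A \<subseteq> U}"
    by (rule countable_subset[of _ towers]) (auto simp: towers_def)
  then have "\<Union>{A \<in> towers. A \<subseteq> U} \<in> sigma_sets (topspace X) towers"
    using sigma_sets_UNION by (metis (no_types, lifting) mem_Collect_eq sigma_sets.Basic subsetI)
  ultimately show "U \<in> sigma_sets (topspace X) towers"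
    by simp
next
  fix A assume "A \<in> towers"
  then show "A \<in> sigma_sets (topspace X) {U. openin X U}"
    using openin_tower by (auto simp: towers_def intro: sigma_sets.Empty sigma_sets.Basic)
qed

section \<open>Measures of the tower bases\<close>

lemma tower_in_sets: "invariant_measure X T M \<Longrightarrow> tower n v i \<in> sets M"
  using openin_in_sets openin_tower by blast

definition base_measure :: "'a measure \<Rightarrow> nat \<Rightarrow> nat \<times> nat \<Rightarrow> real" where
  "base_measure M n v = measure M (tower n v 0)"

lemma base_measure_nonneg: "0 \<le> base_measure M n v"
  by (simp add: base_measure_def)

lemma measure_tower:
  assumes M: "invariant_measure X T M"
  shows "i < height n v \<Longrightarrow> measure M (tower n v i) = base_measure M n v"
proof (induction i)
  case (Suc i)
  have "emeasure M (T -` tower n v (Suc i) \<inter> space M) = emeasure M (tower n v (Suc i))"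
    using M tower_in_sets[OF M] unfolding invariant_measure_def by blast
  then have "measure M (tower n v i) = measure M (tower n v (Suc i))"
    using tower_vimage[OF Suc.prems] by (simp add: space_invariant_measure[OF M] measure_def)
  with Suc show ?case
    by simp
qed (simp add: base_measure_def)

text \<open>The pieces cut out by the next edge are floors of level \<open>n + 1\<close>, and a
  floor has the measure of the base of its tower.\<close>

lemma base_measure_refine:
  assumes M: "invariant_measure X T M"
  shows "base_measure M n w = (\<Sum>e | e \<in> edges B (Suc n) \<and> init_pt B e = w. base_measure M (Suc n) (end_pt B e))"
proof -
  interpret prob_space M
    using M by (simp add: invariant_measure_def)
  let ?E = "{e \<in> edges B (Suc n). init_pt B e = w}"
  let ?D = "\<lambda>e. {x \<in> tower n w 0. h x n = e}"
  have D: "tower (Suc n) (end_pt B e) (edge_offset n e) = ?D e" if "e \<in> ?E" for e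
    using tower_refine[of e n] that by auto
  have "tower n w 0 = (\<Union>e\<in>?E. ?D e)"
    using pathsD(1)[OF h_in_paths] by (auto simp: tower_def)
  then have "base_measure M n w = measure M (\<Union>e\<in>?E. ?D e)"
    by (simp add: base_measure_def)
  also have "\<dots> = (\<Sum>e\<in>?E. measure M (?D e))"
  proof (rule finite_measure_finite_Union)
    show "?D ` ?E \<subseteq> sets M"
      using D tower_in_sets[OF M] by (metis (no_types, lifting) image_subsetI)
  qed (use finite_edges in \<open>auto simp: disjoint_family_on_def\<close>)
  also have "\<dots> = (\<Sum>e\<in>?E. base_measure M (Suc n) (end_pt B e))"
  proof (rule sum.cong[OF refl])
    fix e assume e: "e \<in> ?E"
    have "edge_offset n e < height (Suc n) (end_pt B e)"
      using edge_offset_add_height_le_height[of e n] height_pos[OF init_pt_in[of e n]] e by simp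
    then show "measure M (?D e) = base_measure M (Suc n) (end_pt B e)"
      using measure_tower[OF M] D[OF e] by metis
  qed
  finally show ?thesis
    by simp
qed

lemma sum_base_measure:
  assumes M: "invariant_measure X T M"
  shows "(\<Sum>v\<in>vertices B n. base_measure M n v * height n v) = 1"
proof -
  interpret prob_space M
    using M by (simp add: invariant_measure_def)
  let ?P = "SIGMA v:vertices B n. {..<height n v}"
  let ?F = "\<lambda>(v, i). tower n v i"
  have "topspace X = (\<Union>p\<in>?P. ?F p)"
  proof (intro equalityI subsetI)
    fix x assume "x \<in> topspace X"
    then have "x \<in> tower n (init_pt B (h x n)) (floor_of n (h x))"
      by (simp add: tower_def)
    with tower_level[OF this] show "x \<in> (\<Union>p\<in>?P. ?F p)"
      by blast
  qed (auto simp: tower_def)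
  then have "1 = measure M (\<Union>p\<in>?P. ?F p)"
    using prob_space space_invariant_measure[OF M] by simp
  also have "\<dots> = (\<Sum>p\<in>?P. measure M (?F p))"
    by (rule finite_measure_finite_Union)
      (use finite_vertices tower_in_sets[OF M] in \<open>auto simp: disjoint_family_on_def tower_def\<close>)
  also have "\<dots> = (\<Sum>v\<in>vertices B n. \<Sum>i<height n v. measure M (tower n v i))"
    by (subst sum.Sigma) (auto simp: finite_vertices split_def)
  also have "\<dots> = (\<Sum>v\<in>vertices B n. base_measure M n v * height n v)"
    by (intro sum.cong refl) (simp add: measure_tower[OF M] mult.commute)
  finally show ?thesis
    by simp
qed

text \<open>Double counting of the edges, by initial point and by end-point: base measures are
  carried down by the transpose of the incidence matrix that carries \<open>g\<close> up.\<close>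

lemma sum_base_measure_refine:
  assumes M: "invariant_measure X T M"
    and g: "\<And>v. v \<in> vertices B (Suc n) \<Longrightarrow> g' v = (\<Sum>e\<in>edges_into v. g (init_pt B e))"
  shows "(\<Sum>v\<in>vertices B n. base_measure M n v * g v) =
    (\<Sum>v\<in>vertices B (Suc n). base_measure M (Suc n) v * (g' v :: real))"
proof -
  have "(\<Sum>v\<in>vertices B n. base_measure M n v * g v) =
    (\<Sum>v\<in>vertices B n. \<Sum>e | e \<in> edges B (Suc n) \<and> init_pt B e = v.
       base_measure M (Suc n) (end_pt B e) * g (init_pt B e))"
    by (intro sum.cong refl) (simp add: base_measure_refine[OF M, of n] sum_distrib_right)
  also have "\<dots> = (\<Sum>e\<in>edges B (Suc n). base_measure M (Suc n) (end_pt B e) * g (init_pt B e))"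
    by (rule sum.group) (auto simp: finite_edges finite_vertices init_pt_in)
  also have "\<dots> = (\<Sum>v\<in>vertices B (Suc n). \<Sum>e | e \<in> edges B (Suc n) \<and> end_pt B e = v.
       base_measure M (Suc n) (end_pt B e) * g (init_pt B e))"
    by (rule sum.group[symmetric]) (auto simp: finite_edges finite_vertices end_pt_in)
  also have "\<dots> = (\<Sum>v\<in>vertices B (Suc n). base_measure M (Suc n) v * g' v)"
    by (intro sum.cong refl) (simp add: g edges_into_level sum_distrib_left)
  finally show ?thesis .
qed

section \<open>Visits to the bases and continuous eigenvalues\<close>

lemma bases_shrink:
  assumes U: "openin X U" and x0: "x0 \<in> U" "min_path B (h x0)"
  shows "\<exists>N. \<forall>n\<ge>N. \<forall>x\<in>topspace X. floor_of n (h x) = 0 \<longrightarrow> x \<in> U"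
proof -
  \<comment> \<open>The parts of the bases outside \<open>U\<close> are closed and nested. A common
    point would have the unique minimal path, hence be \<open>x0\<close>, so by compactness some
    \<open>C n\<close> is empty.\<close>
  define C where "C n = {x \<in> topspace X. x \<notin> U \<and> floor_of n (h x) = 0}" for n
  have closed: "closedin X (C n)" for n
  proof -
    have "topspace X - C n = U \<union> (\<Union>v. \<Union>i\<in>{0<..}. tower n v i)"
      using openin_subset[OF U] by (auto simp: C_def tower_def)
    moreover have "openin X (U \<union> (\<Union>v. \<Union>i\<in>{0<..}. tower n v i))"
      using U openin_tower by (intro openin_Un openin_Union) auto
    ultimately show ?thesis
      by (auto simp: closedin_def C_def)
  qed
  have dec: "C n \<subseteq> C m" if "m \<le> n" for m n
    using that floor_of_eq_0_iff[OF h_in_paths] by (auto simp: C_def)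
  have "\<exists>N. C N = {}"
  proof (rule ccontr)
    assume "\<nexists>N. C N = {}"
    then have "(\<Inter>n. C n) \<noteq> {}"
      using compact_space_imp_nest[OF compact, of C] closed dec by (auto simp: antimono_def)
    then obtain x where x: "x \<in> topspace X" "x \<notin> U" "\<And>n. floor_of n (h x) = 0"
      by (auto simp: C_def)
    then have "minimal_edge B (h x i)" for i
      using floor_of_eq_0_iff[OF h_in_paths[OF x(1)], of "Suc i"] x(3)[of "Suc i"] by simp
    then have "min_path B (h x)"
      using h_in_paths[OF x(1)] by (simp add: min_path_def)
    moreover have "\<exists>!p. min_path B p"
      using proper by (simp add: properly_ordered_def)
    ultimately have "h x = h x0"
      using x0(2) by blast
    then show False
      using h_inj[of x x0] x x0(1) openin_subset[OF U] by auto
  qed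
  then obtain N where N: "C N = {}"
    by blast
  have "x \<in> U" if "n \<ge> N" "x \<in> topspace X" "floor_of n (h x) = 0" for n x
  proof (rule ccontr)
    assume "x \<notin> U"
    with that have "x \<in> C n"
      by (simp add: C_def)
    with dec[OF that(1)] N show False
      by blast
  qed
  then show ?thesis
    by blast
qed

lemma ex_return_to_base:
  assumes "x \<in> topspace X"
  shows "\<exists>j. floor_of n (h ((T ^^ j) x)) = 0"
  using assms
proof (induction "height n (init_pt B (h x n)) - floor_of n (h x)" arbitrary: x rule: less_induct)
  case less
  note p = h_in_paths[OF less.prems]
  show ?case
  proof (cases "\<forall>i<n. maximal_edge B (h x i)")
    case True
    from floor_of_vershik_maximal[OF p this] have "floor_of n (h ((T ^^ 1) x)) = 0"
      using less.prems by (simp add: h_T)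
    then show ?thesis
      by blast
  next
    case False
    then have "\<exists>i<n. \<not> maximal_edge B (h x i)"
      by blast
    note V = floor_of_vershik[OF p this]
    have "\<exists>j. floor_of n (h ((T ^^ j) (T x))) = 0"
      using less.prems V floor_of_less[OF p, of n] by (intro less.hyps) (auto simp: h_T T_in)
    then obtain j where "floor_of n (h ((T ^^ Suc j) x)) = 0"
      by (auto simp: funpow_swap1)
    then show ?thesis
      by blast
  qed
qed

lemma eigenvalue_return_times:
  assumes \<alpha>: "\<alpha> \<in> eigenvalue_group X T" and e: "e > 0"
  shows "\<exists>N. \<forall>n\<ge>N. \<forall>x\<in>topspace X. \<forall>j. floor_of n (h x) = 0 \<longrightarrow> floor_of n (h ((T ^^ j) x)) = 0 \<longrightarrow>
    \<bar>near_frac (\<alpha> * real j)\<bar> < e"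
proof -
  define c where "c = exp (2 * \<i> * complex_of_real pi * complex_of_real \<alpha>)"
  have "norm c = 1"
    by (simp add: c_def)
  have c_power: "c ^ j = exp (2 * \<i> * complex_of_real pi * complex_of_real (\<alpha> * real j))" for j
    by (simp add: c_def mult_ac flip: exp_of_nat_mult)
  obtain f where f: "continuous_map X euclidean f" "\<exists>x\<in>topspace X. f x \<noteq> 0"
    "\<And>x. x \<in> topspace X \<Longrightarrow> f (T x) = c * f x"
    using \<alpha> unfolding eigenvalue_group_def continuous_eigenvalue_def c_def by blast
  have f_pow: "f ((T ^^ j) x) = c ^ j * f x" if "x \<in> topspace X" for j x
    by (induction j) (use that f(3) funpow_T_in in auto)
  have open_f: "openin X {x \<in> topspace X. f x \<in> S}" if "open S" for S
    using f(1) that by (simp add: continuous_map_def)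
  obtain x0 where x0: "x0 \<in> topspace X" "min_path B (h x0)"
    using ex_base_point by blast
  \<comment> \<open>The modulus of \<open>f\<close> is constant along orbits, and every orbit visits
    every base. If \<open>f x0\<close> were 0, a deep base would only have values smaller than the
    modulus on the orbit of \<open>x1\<close>.\<close>
  have "f x0 \<noteq> 0"
  proof
    assume "f x0 = 0"
    obtain x1 where x1: "x1 \<in> topspace X" "f x1 \<noteq> 0"
      using f(2) by blast
    have "x0 \<in> {x \<in> topspace X. f x \<in> ball 0 (norm (f x1))}"
      using x0(1) x1(2) \<open>f x0 = 0\<close> by simp
    from bases_shrink[OF open_f[OF open_ball] this x0(2)]
    obtain N where N: "\<forall>x\<in>topspace X. floor_of N (h x) = 0 \<longrightarrow> norm (f x) < norm (f x1)"
      by auto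
    obtain j where "floor_of N (h ((T ^^ j) x1)) = 0"
      using ex_return_to_base[OF x1(1)] by blast
    then have "norm (f ((T ^^ j) x1)) < norm (f x1)"
      using N funpow_T_in[OF x1(1)] by blast
    then show False
      using f_pow[OF x1(1)] \<open>norm c = 1\<close> by (simp add: norm_mult norm_power)
  qed
  obtain r where r: "r > 0"
    "\<And>t. norm (exp (2 * \<i> * complex_of_real pi * complex_of_real t) - 1) < r \<Longrightarrow> \<bar>near_frac t\<bar> < e"
    using near_frac_small[OF e] by blast
  \<comment> \<open>The first bound keeps the modulus of \<open>f\<close> above half of its value at
    \<open>x0\<close> on the base; the second makes \<open>2 * s\<close> at most \<open>r\<close>
    times that half.\<close>
  define s where "s = min (norm (f x0) / 2) (r * norm (f x0) / 4)"
  have "s > 0"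
    using r(1) \<open>f x0 \<noteq> 0\<close> by (simp add: s_def)
  then have "x0 \<in> {x \<in> topspace X. f x \<in> ball (f x0) s}"
    using x0(1) by simp
  from bases_shrink[OF open_f[OF open_ball] this x0(2)]
  obtain N where N: "\<And>n x. n \<ge> N \<Longrightarrow> x \<in> topspace X \<Longrightarrow> floor_of n (h x) = 0 \<Longrightarrow> norm (f x0 - f x) < s"
    by (auto simp: dist_norm)
  have "\<bar>near_frac (\<alpha> * real j)\<bar> < e"
    if n: "n \<ge> N" and x: "x \<in> topspace X" "floor_of n (h x) = 0" "floor_of n (h ((T ^^ j) x)) = 0" for n x j
  proof (rule r(2))
    define y where "y = (T ^^ j) x"
    have fx: "norm (f x0 - f x) < s" and fy: "norm (f x0 - f y) < s"
      using N[OF n] x funpow_T_in by (auto simp: y_def)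
    have "norm (f x) \<ge> norm (f x0) - norm (f x0 - f x)"
      using norm_triangle_ineq2[of "f x0" "f x0 - f x"] by simp
    then have large: "norm (f x) > norm (f x0) / 2"
      using fx by (simp add: s_def)
    have "norm (c ^ j - 1) * norm (f x) = norm (f y - f x)"
      using f_pow[OF x(1), of j] by (simp add: y_def left_diff_distrib flip: norm_mult)
    also have "\<dots> = norm ((f x0 - f x) - (f x0 - f y))"
      by simp
    also have "\<dots> \<le> norm (f x0 - f x) + norm (f x0 - f y)"
      by (rule norm_triangle_ineq4)
    also have "\<dots> < 2 * s"
      using fx fy by simp
    also have "\<dots> \<le> r * (norm (f x0) / 2)"
      by (simp add: s_def)
    also have "\<dots> \<le> r * norm (f x)"
      using large r(1) by (intro mult_left_mono) auto
    finally have "norm (c ^ j - 1) < r"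
      using large by (simp add: mult_less_cancel_right)
    then show "norm (exp (2 * \<i> * complex_of_real pi * complex_of_real (\<alpha> * real j)) - 1) < r"
      by (simp only: c_power)
  qed
  then show ?thesis
    by blast
qed

text \<open>Both numbers are times between visits to the union of the bases of level
  \<open>n\<close>: a height leads from a base back to some base, and an offset leads from a base of
  level \<open>n + 1\<close>, which lies in a base of level \<open>n\<close>, to the copy belonging
  to \<open>f\<close>.\<close>

lemma eigenvalue_heights:
  assumes "\<alpha> \<in> eigenvalue_group X T" "e > 0"
  shows "\<exists>N. \<forall>n\<ge>N. (\<forall>v\<in>vertices B n. \<bar>near_frac (\<alpha> * height n v)\<bar> < e) \<and>
    (\<forall>f\<in>edges B (Suc n). \<bar>near_frac (\<alpha> * edge_offset n f)\<bar> < e)"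
proof -
  obtain N where N: "\<And>n x j. n \<ge> N \<Longrightarrow> x \<in> topspace X \<Longrightarrow> floor_of n (h x) = 0 \<Longrightarrow>
      floor_of n (h ((T ^^ j) x)) = 0 \<Longrightarrow> \<bar>near_frac (\<alpha> * real j)\<bar> < e"
    using eigenvalue_return_times[OF assms] by blast
  have "\<bar>near_frac (\<alpha> * height n v)\<bar> < e" if n: "n \<ge> N" and v: "v \<in> vertices B n" for n v
  proof -
    obtain x where x: "x \<in> tower n v 0"
      using ex_tower_base[OF v] by blast
    show ?thesis
      by (rule N[OF n _ _ tower_return[OF x]]) (use x in \<open>auto simp: tower_def\<close>)
  qed
  moreover have "\<bar>near_frac (\<alpha> * edge_offset n f)\<bar> < e" if n: "n \<ge> N" and f: "f \<in> edges B (Suc n)" for n f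
  proof -
    obtain x where x: "x \<in> tower (Suc n) (end_pt B f) 0"
      using ex_tower_base[OF end_pt_in[OF f]] by blast
    have "edge_offset n f < height (Suc n) (end_pt B f)"
      using edge_offset_add_height_le_height[OF f] height_pos[OF init_pt_in[OF f]] by linarith
    from tower_climb[OF x this] have "(T ^^ edge_offset n f) x \<in> tower n (init_pt B f) 0"
      using tower_refine[OF f] by blast
    then show ?thesis
      using x by (intro N[OF n, of x]) (auto simp: tower_def)
  qed
  ultimately show ?thesis
    by blast
qed

section \<open>The integer vectors of an eigenvalue\<close>

definition eigen_vector :: "real \<Rightarrow> nat \<Rightarrow> nat \<times> nat \<Rightarrow> int" where
  "eigen_vector \<alpha> n v = round (\<alpha> * height n v)"

text \<open>Since all \<open>\<alpha> * edge_offset n e\<close> are close to integers, rounding is additive along the edges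
  into a vertex.\<close>

lemma eigen_vector_refine:
  assumes "\<alpha> \<in> eigenvalue_group X T"
  shows "\<exists>N. \<forall>n\<ge>N. \<forall>v\<in>vertices B (Suc n).
    eigen_vector \<alpha> (Suc n) v = (\<Sum>e\<in>edges_into v. eigen_vector \<alpha> n (init_pt B e))"
proof -
  obtain N where N: "\<And>n v. n \<ge> N \<Longrightarrow> v \<in> vertices B n \<Longrightarrow> \<bar>near_frac (\<alpha> * height n v)\<bar> < 1 / 4"
    "\<And>n f. n \<ge> N \<Longrightarrow> f \<in> edges B (Suc n) \<Longrightarrow> \<bar>near_frac (\<alpha> * edge_offset n f)\<bar> < 1 / 4"
    using eigenvalue_heights[OF assms, of "1 / 4"] by auto
  have "eigen_vector \<alpha> (Suc n) v = (\<Sum>e\<in>edges_into v. eigen_vector \<alpha> n (init_pt B e))"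
    if n: "n \<ge> N" and v: "v \<in> vertices B (Suc n)" for n v
  proof -
    have add: "round (\<alpha> * height n (init_pt B e) + \<alpha> * edge_offset n e) =
        eigen_vector \<alpha> n (init_pt B e) + round (\<alpha> * edge_offset n e)"
      if "e \<in> edges B (Suc n)" for e
      unfolding eigen_vector_def using N[OF n] init_pt_in that by (intro round_add) auto
    have below: "round (\<alpha> * edge_offset n e) = (\<Sum>f\<in>below e. eigen_vector \<alpha> n (init_pt B f))"
      if "e \<in> edges B (Suc n)" for e
      using that
    proof (induction e rule: edge_induct)
      case (step e)
      show ?case
      proof (cases "below e = {}")
        case True
        then show ?thesis
          by (simp add: edge_offset_def)
      next
        case False
        then obtain f where f: "f \<in> below e" "below e = insert f (below f)" "f \<notin> below f"
          using below_predecessor step.hyps by blast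
        have fe: "f \<in> edges B (Suc n)"
          using below_level[OF step.hyps f(1)] .
        have "edge_offset n e = height n (init_pt B f) + edge_offset n f"
          using f finite_below[OF fe] by (simp add: edge_offset_def)
        then have "round (\<alpha> * edge_offset n e) =
            eigen_vector \<alpha> n (init_pt B f) + (\<Sum>g\<in>below f. eigen_vector \<alpha> n (init_pt B g))"
          using add[OF fe] step.IH[OF f(1)] by (simp add: distrib_left)
        then show ?thesis
          using f finite_below[OF fe] by simp
      qed
    qed
    obtain e where e: "e \<in> edges B (Suc n)" "end_pt B e = v" "maximal_edge B e"
      using ex_maximal_edge[OF v] by blast
    have "eigen_vector \<alpha> (Suc n) v = round (\<alpha> * height n (init_pt B e) + \<alpha> * edge_offset n e)"
      using height_Suc_maximal_edge[OF e(1,3)] e(2)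
      by (simp only: eigen_vector_def of_nat_add distrib_left)
    then show ?thesis
      using add[OF e(1)] below[OF e(1)] edges_into_maximal_edge[OF e(1,3)] e(2) finite_below[OF e(1)]
      by simp
  qed
  then show ?thesis
    by blast
qed

lemma near_frac_height:
  fixes \<alpha> :: real
  shows "near_frac (\<alpha> * height n v) = \<alpha> * height n v - of_int (eigen_vector \<alpha> n v)"
  by (simp add: near_frac_def eigen_vector_def)

lemma eigen_vector_pairing:
  assumes \<alpha>: "\<alpha> \<in> eigenvalue_group X T" and M: "invariant_measure X T M"
    and refine: "\<And>n v. n \<ge> N \<Longrightarrow> v \<in> vertices B (Suc n) \<Longrightarrow>
      eigen_vector \<alpha> (Suc n) v = (\<Sum>e\<in>edges_into v. eigen_vector \<alpha> n (init_pt B e))"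
  shows "(\<Sum>v\<in>vertices B N. base_measure M N v * of_int (eigen_vector \<alpha> N v)) = \<alpha>"
proof -
  define P where "P n = (\<Sum>v\<in>vertices B n. base_measure M n v * near_frac (\<alpha> * height n v))" for n
  have P_Suc: "P (Suc n) = P n" if "n \<ge> N" for n
    unfolding P_def
  proof (rule sum_base_measure_refine[OF M, symmetric])
    fix v assume "v \<in> vertices B (Suc n)"
    from refine[OF that this]
    show "near_frac (\<alpha> * height (Suc n) v) = (\<Sum>e\<in>edges_into v. near_frac (\<alpha> * height n (init_pt B e)))"
      by (simp only: near_frac_height) (simp add: sum_subtractf sum_distrib_left)
  qed
  have P_const: "P n = P N" if "n \<ge> N" for n
    using that by (induction n rule: dec_induct) (auto simp: P_Suc)
  have small: "\<bar>P N\<bar> \<le> e" if e: "e > 0" for e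
  proof -
    obtain N' where N': "\<And>n v. n \<ge> N' \<Longrightarrow> v \<in> vertices B n \<Longrightarrow> \<bar>near_frac (\<alpha> * height n v)\<bar> < e"
      using eigenvalue_heights[OF \<alpha> e] by blast
    define n where "n = max N N'"
    have "\<bar>P n\<bar> \<le> (\<Sum>v\<in>vertices B n. \<bar>base_measure M n v * near_frac (\<alpha> * height n v)\<bar>)"
      unfolding P_def by (rule sum_abs)
    also have "\<dots> \<le> (\<Sum>v\<in>vertices B n. base_measure M n v * height n v * e)"
    proof (rule sum_mono)
      fix v assume v: "v \<in> vertices B n"
      \<comment> \<open>Inserting the height, which is at least 1, turns the weights into the masses
        of whole towers, whose sum is 1.\<close>
      have "1 * \<bar>near_frac (\<alpha> * height n v)\<bar> \<le> real (height n v) * e"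
        using N'[of n v] v height_pos[OF v] by (intro mult_mono) (auto simp: n_def)
      then show "\<bar>base_measure M n v * near_frac (\<alpha> * height n v)\<bar> \<le> base_measure M n v * height n v * e"
        using mult_left_mono[OF _ base_measure_nonneg] by (simp add: abs_mult base_measure_nonneg mult.assoc)
    qed
    also have "\<dots> = e"
      using sum_base_measure[OF M, of n] by (simp flip: sum_distrib_right)
    finally show ?thesis
      using P_const[of n] by (simp add: n_def)
  qed
  have "P N = 0"
  proof (rule ccontr)
    assume "P N \<noteq> 0"
    then show False
      using small[of "\<bar>P N\<bar> / 2"] by simp
  qed
  then have "\<alpha> * (\<Sum>v\<in>vertices B N. base_measure M N v * height N v) =
      (\<Sum>v\<in>vertices B N. base_measure M N v * of_int (eigen_vector \<alpha> N v))"
    unfolding P_def near_frac_height right_diff_distrib sum_subtractf sum_distrib_left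
    by (simp add: mult_ac)
  then show ?thesis
    using sum_base_measure[OF M, of N] by simp
qed

text \<open>A real relation between integer vectors yields a rational one with a nonzero
  coefficient, and \<open>refine\<close> carries it to all higher levels. There the combination
  \<open>s\<close> of the eigenvalues, times a height, equals a combination of errors tending to 0.
  Heights are at least 1, so \<open>s = 0\<close>, against rational independence.\<close>

lemma eigen_vectors_independent:
  assumes S: "finite S" "S \<subseteq> eigenvalue_group X T" "rationally_independent S"
    and refine: "\<And>\<alpha> n v. \<alpha> \<in> S \<Longrightarrow> n \<ge> N \<Longrightarrow> v \<in> vertices B (Suc n) \<Longrightarrow>
      eigen_vector \<alpha> (Suc n) v = (\<Sum>e\<in>edges_into v. eigen_vector \<alpha> n (init_pt B e))"
  shows "independent_family (vertices B N) S (\<lambda>\<alpha> v. of_int (eigen_vector \<alpha> N v))"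
  unfolding independent_family_def
proof (intro allI impI ballI, rule ccontr)
  fix a :: "real \<Rightarrow> real" and \<alpha>0
  assume a: "\<forall>v\<in>vertices B N. (\<Sum>\<alpha>\<in>S. a \<alpha> * of_int (eigen_vector \<alpha> N v)) = 0"
    and \<alpha>0: "\<alpha>0 \<in> S" "a \<alpha>0 \<noteq> 0"
  obtain q :: "real \<Rightarrow> rat" where q: "q \<alpha>0 = 1"
    "\<And>v. v \<in> vertices B N \<Longrightarrow> (\<Sum>\<alpha>\<in>S. q \<alpha> * of_int (eigen_vector \<alpha> N v)) = 0"
    using rational_solution_of_real_solution[of a \<alpha>0 "vertices B N" "\<lambda>\<alpha>. eigen_vector \<alpha> N" S] a \<alpha>0(2)
    by blast
  have q0: "(\<Sum>\<alpha>\<in>S. q \<alpha> * of_int (eigen_vector \<alpha> n v)) = 0" if "n \<ge> N" "v \<in> vertices B n" for n v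
    using that
  proof (induction n arbitrary: v rule: dec_induct)
    case base
    then show ?case
      by (rule q(2))
  next
    case (step n)
    have "(\<Sum>\<alpha>\<in>S. q \<alpha> * of_int (eigen_vector \<alpha> (Suc n) v)) =
        (\<Sum>\<alpha>\<in>S. \<Sum>e\<in>edges_into v. q \<alpha> * of_int (eigen_vector \<alpha> n (init_pt B e)))"
      using refine[OF _ step.hyps(1) step.prems] by (simp add: sum_distrib_left)
    also have "\<dots> = (\<Sum>e\<in>edges_into v. \<Sum>\<alpha>\<in>S. q \<alpha> * of_int (eigen_vector \<alpha> n (init_pt B e)))"
      by (rule sum.swap)
    also have "\<dots> = 0"
      using step.IH init_pt_in by (intro sum.neutral) (auto simp: edges_into_level[OF step.prems])
    finally show ?case .
  qed
  define s where "s = (\<Sum>\<alpha>\<in>S. of_rat (q \<alpha>) * \<alpha>)"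
  define Q where "Q = (\<Sum>\<alpha>\<in>S. \<bar>real_of_rat (q \<alpha>)\<bar>)"
  have small: "\<bar>s\<bar> \<le> Q * e" if e: "e > 0" for e
  proof -
    have "\<exists>N. \<forall>n\<ge>N. \<forall>v\<in>vertices B n. \<bar>near_frac (\<alpha> * height n v)\<bar> < e" if "\<alpha> \<in> S" for \<alpha>
      using eigenvalue_heights[of \<alpha> e] S(2) e that by blast
    then obtain N' where N': "\<And>\<alpha> n v. \<alpha> \<in> S \<Longrightarrow> n \<ge> N' \<alpha> \<Longrightarrow> v \<in> vertices B n \<Longrightarrow>
        \<bar>near_frac (\<alpha> * height n v)\<bar> < e"
      by metis
    define n where "n = Max (insert N (N' ` S))"
    have n: "n \<ge> N" "\<And>\<alpha>. \<alpha> \<in> S \<Longrightarrow> n \<ge> N' \<alpha>"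
      using S(1) by (auto simp: n_def)
    obtain x where "x \<in> topspace X"
      using ex_base_point by blast
    then have v: "init_pt B (h x n) \<in> vertices B n" (is "?v \<in> _")
      using pathsD(3)[OF h_in_paths] by blast
    have "real_of_rat (\<Sum>\<alpha>\<in>S. q \<alpha> * of_int (eigen_vector \<alpha> n ?v)) = 0"
      using q0[OF n(1) v] by simp
    then have "(\<Sum>\<alpha>\<in>S. of_rat (q \<alpha>) * of_int (eigen_vector \<alpha> n ?v)) = (0::real)"
      by (simp add: of_rat_sum of_rat_mult)
    then have "s * height n ?v = (\<Sum>\<alpha>\<in>S. of_rat (q \<alpha>) * near_frac (\<alpha> * height n ?v))"
      unfolding near_frac_height right_diff_distrib sum_subtractf s_def sum_distrib_right
      by (simp add: mult_ac)
    then have "\<bar>s\<bar> * height n ?v \<le> (\<Sum>\<alpha>\<in>S. \<bar>of_rat (q \<alpha>) * near_frac (\<alpha> * height n ?v)\<bar>)"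
      using sum_abs[of "\<lambda>\<alpha>. of_rat (q \<alpha>) * near_frac (\<alpha> * height n ?v)" S]
      by (metis abs_mult abs_of_nat)
    also have "\<dots> \<le> (\<Sum>\<alpha>\<in>S. \<bar>real_of_rat (q \<alpha>)\<bar> * e)"
      unfolding abs_mult by (intro sum_mono mult_left_mono less_imp_le[OF N'[OF _ n(2) v]]) auto
    finally have "\<bar>s\<bar> * height n ?v \<le> Q * e"
      by (simp add: Q_def sum_distrib_right)
    moreover have "\<bar>s\<bar> * 1 \<le> \<bar>s\<bar> * height n ?v"
      using height_pos[OF v] by (intro mult_left_mono) auto
    ultimately show ?thesis
      by simp
  qed
  have "Q \<ge> 0"
    by (simp add: Q_def sum_nonneg)
  have "s = 0"
  proof (rule ccontr)
    assume "s \<noteq> 0"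
    \<comment> \<open>The tolerance makes the bound smaller than \<open>\<bar>s\<bar>\<close>; the
      \<open>+ 1\<close> avoids division by 0 when \<open>Q = 0\<close>.\<close>
    then have "\<bar>s\<bar> \<le> Q * (\<bar>s\<bar> / (Q + 1) / 2)"
      using \<open>Q \<ge> 0\<close> by (intro small) auto
    also have "\<dots> < \<bar>s\<bar>"
      using \<open>Q \<ge> 0\<close> \<open>s \<noteq> 0\<close> by (simp add: field_simps add_nonneg_pos)
    finally show False
      by simp
  qed
  then have "q \<alpha>0 = 0"
    using rationally_independentD[OF S(3,1) _ \<alpha>0(1), of q] by (simp add: s_def)
  with q(1) show False
    by simp
qed

text \<open>Relations on the bases of level \<open>n + 1\<close> are also relations on those of
  level \<open>n\<close>, so the spaces \<open>K n\<close> decrease. A relation valid on all levels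
  annihilates every floor, hence every Borel set, and singularity makes it trivial. Stabilization
  then gives one level from which on no nontrivial relation survives.\<close>

lemma base_measures_independent:
  assumes J: "finite J" "J \<subseteq> ergodic_measures X T"
  shows "\<exists>N. \<forall>n\<ge>N. independent_family (vertices B n) J (\<lambda>M. base_measure M n)"
proof -
  have inv: "invariant_measure X T M" if "M \<in> J" for M
    using J that by (auto simp: ergodic_measures_def)
  define K where "K n = {c. \<forall>v\<in>vertices B n. (\<Sum>M\<in>J. c M * base_measure M n v) = 0}" for n
  have K_Suc: "K (Suc n) \<subseteq> K n" for n
  proof
    fix c assume c: "c \<in> K (Suc n)"
    have "(\<Sum>M\<in>J. c M * base_measure M n v) = 0" if "v \<in> vertices B n" for v
    proof -
      let ?E = "{e \<in> edges B (Suc n). init_pt B e = v}"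
      have "(\<Sum>M\<in>J. c M * base_measure M n v) =
          (\<Sum>M\<in>J. \<Sum>e\<in>?E. c M * base_measure M (Suc n) (end_pt B e))"
        by (intro sum.cong refl) (simp add: base_measure_refine[OF inv, of _ n] sum_distrib_left)
      also have "\<dots> = (\<Sum>e\<in>?E. \<Sum>M\<in>J. c M * base_measure M (Suc n) (end_pt B e))"
        by (rule sum.swap)
      also have "\<dots> = 0"
        using c end_pt_in by (intro sum.neutral) (auto simp: K_def)
      finally show ?thesis .
    qed
    then show "c \<in> K n"
      by (simp add: K_def)
  qed
  have K_dec: "K n' \<subseteq> K n" if "n \<le> n'" for n n'
    using that by (induction n' rule: dec_induct) (use K_Suc in auto)
  have inter: "c = (\<lambda>_. 0)" if c: "\<And>n. c \<in> K n" "\<forall>M. M \<notin> J \<longrightarrow> c M = 0" for c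
  proof -
    have tower0: "(\<Sum>M\<in>J. c M * measure M (tower n v i)) = 0" for n v i
    proof (cases "tower n v i = {}")
      case False
      then have "v \<in> vertices B n" "i < height n v"
        using tower_level by blast+
      then show ?thesis
        using c(1)[of n] measure_tower[OF inv] by (simp add: K_def)
    qed simp
    \<comment> \<open>The only tower of level 0 is the whole space, which supplies the total mass
      for the Dynkin argument.\<close>
    have "tower 0 (0, 0) 0 = topspace X"
      using pathsD(3)[OF h_in_paths, of _ 0] by (auto simp: tower_def vertices_def)
    moreover have "measure M (topspace X) = 1" if "M \<in> J" for M
      using prob_space.prob_space inv[OF that] by (force simp: invariant_measure_def)
    ultimately have total: "(\<Sum>M\<in>J. c M) = 0"
      using tower0[of 0 "(0, 0)" 0] by simp
    have "(\<Sum>M\<in>J. c M * measure M A) = 0" if "A \<in> sigma_sets (topspace X) {U. openin X U}" for A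
    proof (rule sum_measure_eq_0_sigma_sets[OF Int_stable_towers towers_subset])
      show "prob_space M \<and> space M = topspace X \<and> sets M = sigma_sets (topspace X) towers"
        if "M \<in> J" for M
        using inv[OF that] sigma_sets_towers by (simp add: invariant_measure_def)
      show "(\<Sum>M\<in>J. c M * measure M A) = 0" if "A \<in> towers" for A
        using that tower0 by (auto simp: towers_def)
      show "A \<in> sigma_sets (topspace X) towers"
        using that sigma_sets_towers by simp
    qed (rule total)
    then have "c M = 0" if "M \<in> J" for M
      using ergodic_measures_independent[OF T J _ that] by blast
    with c(2) show ?thesis
      by blast
  qed
  have "\<exists>n. \<forall>x\<in>K n. (\<forall>M. M \<notin> J \<longrightarrow> x M = 0) \<longrightarrow> x = (\<lambda>_. 0)"
  proof (rule decreasing_subspaces_trivial[OF J(1)])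
    show "(\<lambda>M. x M - y M) \<in> K n" if "x \<in> K n" "y \<in> K n" for n x y
      using that by (simp add: K_def left_diff_distrib sum_subtractf)
    show "(\<lambda>M. a * x M) \<in> K n" if "x \<in> K n" for n x a
      using that by (simp add: K_def mult.assoc flip: sum_distrib_left)
  qed (use K_dec inter in blast)+
  then obtain N where N: "\<And>x. x \<in> K N \<Longrightarrow> \<forall>M. M \<notin> J \<longrightarrow> x M = 0 \<Longrightarrow> x = (\<lambda>_. 0)"
    by blast
  have "independent_family (vertices B n) J (\<lambda>M. base_measure M n)" if "n \<ge> N" for n
    unfolding independent_family_def
  proof (intro allI impI)
    fix c assume c: "\<forall>v\<in>vertices B n. (\<Sum>M\<in>J. c M * base_measure M n v) = 0"
    \<comment> \<open>\<open>K n\<close> does not see values outside \<open>J\<close>; setting them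
      to 0 gives a vector to which the stabilization result applies.\<close>
    define c' where "c' M = (if M \<in> J then c M else 0)" for M
    have "c' \<in> K n"
      using c by (simp add: K_def c'_def)
    then have "c' = (\<lambda>_. 0)"
      using N[of c'] K_dec[OF that] by (auto simp: c'_def)
    then show "\<forall>M\<in>J. c M = 0"
      unfolding c'_def by metis
  qed
  then show ?thesis
    by blast
qed

section \<open>Dimension counts at a single level\<close>

lemma card_ergodic_measures_le:
  assumes rank: "\<And>n. n \<ge> 1 \<Longrightarrow> num_vertices B n \<le> d" and J: "finite J" "J \<subseteq> ergodic_measures X T"
  shows "card J \<le> d"
proof -
  obtain N where "\<forall>n\<ge>N. independent_family (vertices B n) J (\<lambda>M. base_measure M n)"
    using base_measures_independent[OF J] by blast
  \<comment> \<open>Level \<open>Suc N\<close> is at least 1, where the rank bounds the number of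
    vertices. Paired with an empty family, the orthogonality bound becomes the dimension bound for
    one independent family.\<close>
  then have "independent_family (vertices B (Suc N)) J (\<lambda>M. base_measure M (Suc N))"
    by simp
  moreover have "independent_family (vertices B (Suc N)) {} (\<lambda>_::nat. \<lambda>_. 0)"
    by (simp add: independent_family_def)
  ultimately have "card J \<le> card (vertices B (Suc N))"
    using card_orthogonal_families_le[of "vertices B (Suc N)" "{} :: nat set" J] J(1) finite_vertices
    by force
  also have "\<dots> \<le> d"
    using rank[of "Suc N"] by (simp add: vertices_def card_cartesian_product)
  finally show ?thesis .
qed

text \<open>All \<open>base_measure M n\<close> with \<open>M \<in> J\<close> have the same pairing \<open>\<alpha>\<close> with the eigenvector of
  \<open>\<alpha>\<close>, so their differences are orthogonal to all eigenvectors.\<close>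

lemma card_eigenvalues_le:
  assumes rank: "\<And>n. n \<ge> 1 \<Longrightarrow> num_vertices B n \<le> d" and J: "finite J" "J \<subseteq> ergodic_measures X T"
    and S: "finite S" "S \<subseteq> eigenvalue_group X T" "rationally_independent S"
  shows "card S + (card J - 1) \<le> d"
proof -
  have "\<exists>N. \<forall>n\<ge>N. \<forall>v\<in>vertices B (Suc n).
      eigen_vector \<alpha> (Suc n) v = (\<Sum>e\<in>edges_into v. eigen_vector \<alpha> n (init_pt B e))" if "\<alpha> \<in> S" for \<alpha>
    using eigen_vector_refine S(2) that by blast
  then obtain N where N: "\<And>\<alpha> n v. \<alpha> \<in> S \<Longrightarrow> n \<ge> N \<alpha> \<Longrightarrow> v \<in> vertices B (Suc n) \<Longrightarrow>
      eigen_vector \<alpha> (Suc n) v = (\<Sum>e\<in>edges_into v. eigen_vector \<alpha> n (init_pt B e))"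
    by metis
  obtain N' where N': "\<And>n. n \<ge> N' \<Longrightarrow> independent_family (vertices B n) J (\<lambda>M. base_measure M n)"
    using base_measures_independent[OF J] by blast
  \<comment> \<open>A common level for the measures and the finitely many eigenvalues; the successor
    keeps it above the root, so that the rank bound applies.\<close>
  define n where "n = Suc (Max (insert N' (N ` S)))"
  have "Max (insert N' (N ` S)) \<ge> N'" "\<And>\<alpha>. \<alpha> \<in> S \<Longrightarrow> Max (insert N' (N ` S)) \<ge> N \<alpha>"
    using S(1) by auto
  then have n: "n \<ge> N'" "\<And>\<alpha>. \<alpha> \<in> S \<Longrightarrow> n \<ge> N \<alpha>"
    unfolding n_def by (auto intro: le_SucI)
  define k where "k \<alpha> v = real_of_int (eigen_vector \<alpha> n v)" for \<alpha> v
  have k: "independent_family (vertices B n) S k"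
    unfolding k_def
  proof (rule eigen_vectors_independent[OF S])
    fix \<alpha> m v assume "\<alpha> \<in> S" "m \<ge> n" "v \<in> vertices B (Suc m)"
    then show "eigen_vector \<alpha> (Suc m) v = (\<Sum>e\<in>edges_into v. eigen_vector \<alpha> m (init_pt B e))"
      using n(2) by (intro N) (auto intro: order_trans)
  qed
  have "card (vertices B n) \<le> d"
    using rank[of n] by (simp add: vertices_def card_cartesian_product n_def)
  moreover have "card S + (card J - 1) \<le> card (vertices B n)"
  proof (cases "J = {}")
    \<comment> \<open>For empty \<open>J\<close> the subtraction \<open>card J - 1\<close> truncates
      to 0 and there is no reference measure to subtract, so the eigenvectors are counted
      alone.\<close>
    case True
    have "independent_family (vertices B n) {} (\<lambda>_::nat. \<lambda>_. 0)"
      by (simp add: independent_family_def)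
    then show ?thesis
      using card_orthogonal_families_le[OF finite_vertices S(1) _ k, of "{} :: nat set"] True by force
  next
    case False
    then obtain M0 where M0: "M0 \<in> J"
      by blast
    have pairing: "(\<Sum>v\<in>vertices B n. base_measure M n v * k \<alpha> v) = \<alpha>" if "M \<in> J" "\<alpha> \<in> S" for M \<alpha>
      unfolding k_def
    proof (rule eigen_vector_pairing)
      show "\<alpha> \<in> eigenvalue_group X T" "invariant_measure X T M"
        using that J(2) S(2) by (auto simp: ergodic_measures_def)
      fix m v assume "m \<ge> n" "v \<in> vertices B (Suc m)"
      then show "eigen_vector \<alpha> (Suc m) v = (\<Sum>e\<in>edges_into v. eigen_vector \<alpha> m (init_pt B e))"
        using n(2) that by (intro N) (auto intro: order_trans)
    qed
    have "card S + card (J - {M0}) \<le> card (vertices B n)"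
    proof (rule card_orthogonal_families_le[OF finite_vertices S(1) _ k])
      show "independent_family (vertices B n) (J - {M0}) (\<lambda>M v. base_measure M n v - base_measure M0 n v)"
        using independent_family_diff[OF J(1) M0 N'[OF n(1)]] .
      show "(\<Sum>v\<in>vertices B n. k \<alpha> v * (base_measure M n v - base_measure M0 n v)) = 0"
        if "\<alpha> \<in> S" "M \<in> J - {M0}" for \<alpha> M
        using pairing[of M \<alpha>] pairing[OF M0 that(1)] that
        by (simp add: right_diff_distrib sum_subtractf mult.commute)
    qed (use J in auto)
    then show ?thesis
      using M0 J(1) by simp
  qed
  ultimately show ?thesis
    by linarith
qed

end

lemma cantor_space_imp_compact: "cantor_space X \<Longrightarrow> compact_space X"
  unfolding cantor_space_def
  by (subst homeomorphic_compact_space) (auto simp: compact_space_product_topology compact_space_discrete_topology)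

theorem theorem9:
  fixes X :: "'a topology" and T :: "'a \<Rightarrow> 'a" and d :: nat
  assumes "cantor_minimal_system X T"
    and "finite_rank X T d"
  shows "finite (ergodic_measures X T) \<and> card (ergodic_measures X T) \<le> d \<and>
         eta X T \<le> enat (d - card (ergodic_measures X T) + 1)"
proof -
  obtain B :: "nat bratteli_diagram" where B: "properly_ordered B"
    "conjugate_systems X T (path_space B) (vershik_map B)" "\<And>n. n \<ge> 1 \<Longrightarrow> num_vertices B n \<le> d"
    using assms(2) by (auto simp: finite_rank_def)
  obtain h where h: "homeomorphic_map X (path_space B) h"
    "\<And>x. x \<in> topspace X \<Longrightarrow> h (T x) = vershik_map B (h x)"
    using B(2) by (auto simp: conjugate_systems_def)
  interpret bratteli_vershik_system B X T h
    using assms(1) B(1) h cantor_space_imp_compact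
    by unfold_locales (auto simp: cantor_minimal_system_def)
  have card_le: "card J \<le> d" if "finite J" "J \<subseteq> ergodic_measures X T" for J
    using card_ergodic_measures_le[OF B(3) that] .
  \<comment> \<open>Finiteness comes first, through the bound for finite subsets, because
    \<open>card\<close> of an infinite set is 0 and would make the cardinality bound empty.\<close>
  have fin: "finite (ergodic_measures X T)"
  proof (rule ccontr)
    assume "infinite (ergodic_measures X T)"
    then obtain J where "finite J" "card J = Suc d" "J \<subseteq> ergodic_measures X T"
      using infinite_arbitrarily_large by blast
    then show False
      using card_le[of J] by simp
  qed
  have card: "card (ergodic_measures X T) \<le> d"
    using card_le[OF fin] by simp
  have "eta X T \<le> enat (d - card (ergodic_measures X T) + 1)"
    unfolding eta_def
  proof (rule SUP_least)
    fix S assume "S \<in> {S. finite S \<and> S \<subseteq> eigenvalue_group X T \<and> rationally_independent S}"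
    then have "card S + (card (ergodic_measures X T) - 1) \<le> d"
      using card_eigenvalues_le[OF B(3) fin order_refl, of S] by blast
    with card show "enat (card S) \<le> enat (d - card (ergodic_measures X T) + 1)"
      by simp
  qed
  with fin card show ?thesis
    by blast
qed

end
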